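(* Let $B$ be a finite edge-clean bidirected graph rooted at $r$. Then there is a spanning subgraph $F$ of $B$, rooted at $r$, such that $F$ is a flame and $\lambda_F^{\alpha,\mathrm{path}}(r,v)=\lambda_B^{\alpha,\mathrm{path}}(r,v)$ for every $v\in V(B)\setminus\{r\}$ and every $\alpha\in\{+,-\}$.
   Context: A bidirected graph $B=(G,\sigma)$ is a loopless multigraph $G$ together with a map $\sigma$ assigning to each half-edge $(e,u)$ ($u$ an endpoint of the edge $e$) a sign $\sigma(e,u)\in\{+,-\}$; subgraphs inherit the signs. An oriented edge $\vec e$ is an edge $e$ with a choice of which endpoint is its tail and which its head; $\overleftarrow{e}$ is the opposite orientation. A trail is a sequence $v_0\vec e_1v_1\dots\vec e_\ell v_\ell$ in which the edges $e_i$ are pairwise distinct, $\vec e_i$ has tail $v_{i-1}$ and head $v_i$, and $\sigma(e_{i+1},v_i)=-\sigma(e_i,v_i)$ for $1\le i<\ell$. A path is a trail that does not repeat vertices. A $v$--$(w,\alpha)$ path is a path from $v$ to $w$ whose last edge has sign $\alpha$ at $w$. Two trails are edge-disjoint if they share no underlying edge. $B$ is rooted if it has a designated root vertex $r$. An $r$-trail is a trail starting in $r$ with no internal vertex equal to $r$. An $r$--$\vec e$ trail is an $r$-trail whose last oriented edge is $\vec e$. An edge $e$ is trail-undirectable if there are both an $r$--$\vec e$ trail and an $r$--$\overleftarrow{e}$ trail. $B$ is edge-clean if no trail-undirectable edge is incident with $r$ (equivalently, $r$ lies in no nontrivial connected component of the subgraph formed by the trail-undirectable edges). $\lambda_B^{\alpha,\mathrm{path}}(v,w)$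 is the maximum number of pairwise edge-disjoint $v$--$(w,\alpha)$ paths in $B$. A bidirected graph $F$ rooted at $r$ is a flame if $|E(F)|\le\sum_{v\in V(F)\setminus\{r\}}\sum_{\alpha\in\{+,-\}}\lambda_F^{\alpha,\mathrm{path}}(r,v)$. *)

theory Defs
  imports Main
begin

datatype sign = Plus | Minus

primrec opposite :: "sign \<Rightarrow> sign" where
  "opposite Plus = Minus"
| "opposite Minus = Plus"

text \<open>A bidirected multigraph: parallel edges are distinct elements of \<open>edges B\<close> with the same
  set of endpoints. \<open>sig B e u\<close> is the sign of the half-edge \<open>(e, u)\<close>; its value is irrelevant
  unless \<open>e\<close> is an edge and \<open>u\<close> an endpoint of \<open>e\<close>.\<close>

record ('v, 'e) bidir_graph =
  verts :: "'v set"
  edges :: "'e set"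
  ends :: "'e \<Rightarrow> 'v set"
  sig :: "'e \<Rightarrow> 'v \<Rightarrow> sign"

text \<open>Loops are excluded by requiring exactly two endpoints.\<close>

definition bidirected_graph :: "('v, 'e) bidir_graph \<Rightarrow> bool" where
  "bidirected_graph B \<longleftrightarrow> (\<forall>e\<in>edges B. ends B e \<subseteq> verts B \<and> card (ends B e) = 2)"

definition finite_graph :: "('v, 'e) bidir_graph \<Rightarrow> bool" where
  "finite_graph B \<longleftrightarrow> finite (verts B) \<and> finite (edges B)"

definition subgraph :: "('v, 'e) bidir_graph \<Rightarrow> ('v, 'e) bidir_graph \<Rightarrow> bool" where
  "subgraph F B \<longleftrightarrow> bidirected_graph F \<and> verts F \<subseteq> verts B \<and> edges F \<subseteq> edges B \<and>
     (\<forall>e\<in>edges F. ends F e = ends B e \<and> (\<forall>u\<in>ends F e. sig F e u = sig B e u))"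

definition spanning_subgraph :: "('v, 'e) bidir_graph \<Rightarrow> ('v, 'e) bidir_graph \<Rightarrow> bool" where
  "spanning_subgraph F B \<longleftrightarrow> subgraph F B \<and> verts F = verts B"

text \<open>An oriented edge is a triple (tail, underlying edge, head).\<close>

type_synonym ('v, 'e) oedge = "'v \<times> 'e \<times> 'v"

fun tail :: "('v, 'e) oedge \<Rightarrow> 'v" where "tail (u, e, w) = u"
fun edge :: "('v, 'e) oedge \<Rightarrow> 'e" where "edge (u, e, w) = e"
fun head :: "('v, 'e) oedge \<Rightarrow> 'v" where "head (u, e, w) = w"

definition oriented_edges :: "('v, 'e) bidir_graph \<Rightarrow> ('v, 'e) oedge set" where
  "oriented_edges B = {(u, e, w). e \<in> edges B \<and> ends B e = {u, w}}"

text \<open>A trail \<open>v\<^sub>0 e\<^sub>1 v\<^sub>1 \<dots> e\<^sub>l v\<^sub>l\<close> is given by its start vertex \<open>v\<^sub>0\<close> and the list of its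
  oriented edges. List indices start at 0, so \<open>p ! i\<close> is the edge numbered \<open>i + 1\<close>.\<close>

definition trail_verts :: "'v \<Rightarrow> ('v, 'e) oedge list \<Rightarrow> 'v list" where
  "trail_verts v p = v # map head p"

definition trail :: "('v, 'e) bidir_graph \<Rightarrow> 'v \<Rightarrow> ('v, 'e) oedge list \<Rightarrow> bool" where
  "trail B v p \<longleftrightarrow> v \<in> verts B \<and> set p \<subseteq> oriented_edges B \<and> distinct (map edge p) \<and>
     (\<forall>i<length p. tail (p ! i) = trail_verts v p ! i) \<and>
     (\<forall>i. Suc i < length p \<longrightarrow>
        sig B (edge (p ! Suc i)) (head (p ! i)) = opposite (sig B (edge (p ! i)) (head (p ! i))))"

definition path :: "('v, 'e) bidir_graph \<Rightarrow> 'v \<Rightarrow> ('v, 'e) oedge list \<Rightarrow> bool" where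
  "path B v p \<longleftrightarrow> trail B v p \<and> distinct (trail_verts v p)"

definition path_to ::
  "('v, 'e) bidir_graph \<Rightarrow> 'v \<Rightarrow> 'v \<Rightarrow> sign \<Rightarrow> ('v, 'e) oedge list \<Rightarrow> bool" where
  "path_to B v w \<alpha> p \<longleftrightarrow>
     path B v p \<and> p \<noteq> [] \<and> head (last p) = w \<and> sig B (edge (last p)) w = \<alpha>"

definition edge_disjoint :: "('v, 'e) oedge list \<Rightarrow> ('v, 'e) oedge list \<Rightarrow> bool" where
  "edge_disjoint p q \<longleftrightarrow> edge ` set p \<inter> edge ` set q = {}"

text \<open>The maximum exists whenever \<open>edges B\<close> is finite; see \<open>card_edge_disjoint_paths_le\<close> below.\<close>

definition path_conn :: "('v, 'e) bidir_graph \<Rightarrow> sign \<Rightarrow> 'v \<Rightarrow> 'v \<Rightarrow> nat" where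
  "path_conn B \<alpha> v w =
     Max {card P | P. finite P \<and> (\<forall>p\<in>P. path_to B v w \<alpha> p) \<and> pairwise edge_disjoint P}"

lemma card_edge_disjoint_paths_le:
  assumes "finite (edges B)" "finite P" "\<forall>p\<in>P. path_to B v w \<alpha> p" "pairwise edge_disjoint P"
  shows "card P \<le> card (edges B)"
proof (rule card_inj_on_le)
  have ne: "p \<noteq> []" if "p \<in> P" for p
    using assms(3) that by (auto simp: path_to_def)
  show "inj_on (\<lambda>p. edge (last p)) P"
  proof (rule inj_onI)
    fix p q assume pq: "p \<in> P" "q \<in> P" "edge (last p) = edge (last q)"
    then have "edge (last p) \<in> edge ` set p \<inter> edge ` set q"
      using ne by (metis IntI imageI last_in_set)
    then show "p = q"
      using pq assms(4) by (auto simp: pairwise_def edge_disjoint_def)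
  qed
  show "(\<lambda>p. edge (last p)) ` P \<subseteq> edges B"
  proof (rule image_subsetI)
    fix p assume "p \<in> P"
    then have "last p \<in> oriented_edges B"
      using ne assms(3) last_in_set by (fastforce simp: path_to_def path_def trail_def)
    then show "edge (last p) \<in> edges B"
      by (auto simp: oriented_edges_def)
  qed
qed (fact assms(1))

text \<open>The internal vertices of a trail are the heads of all its edges but the last.\<close>

definition r_trail :: "('v, 'e) bidir_graph \<Rightarrow> 'v \<Rightarrow> ('v, 'e) oedge list \<Rightarrow> bool" where
  "r_trail B r p \<longleftrightarrow> trail B r p \<and> r \<notin> set (map head (butlast p))"

definition r_trail_to ::
  "('v, 'e) bidir_graph \<Rightarrow> 'v \<Rightarrow> ('v, 'e) oedge \<Rightarrow> ('v, 'e) oedge list \<Rightarrow> bool" where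
  "r_trail_to B r a p \<longleftrightarrow> r_trail B r p \<and> p \<noteq> [] \<and> last p = a"

definition trail_undirectable :: "('v, 'e) bidir_graph \<Rightarrow> 'v \<Rightarrow> 'e \<Rightarrow> bool" where
  "trail_undirectable B r e \<longleftrightarrow>
     (\<exists>u w. (u, e, w) \<in> oriented_edges B \<and>
        (\<exists>p. r_trail_to B r (u, e, w) p) \<and> (\<exists>q. r_trail_to B r (w, e, u) q))"

definition edge_clean :: "('v, 'e) bidir_graph \<Rightarrow> 'v \<Rightarrow> bool" where
  "edge_clean B r \<longleftrightarrow> \<not> (\<exists>e\<in>edges B. trail_undirectable B r e \<and> r \<in> ends B e)"

definition flame :: "('v, 'e) bidir_graph \<Rightarrow> 'v \<Rightarrow> bool" where
  "flame F r \<longleftrightarrow>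
     card (edges F) \<le> (\<Sum>v\<in>verts F - {r}. \<Sum>\<alpha>\<in>{Plus, Minus}. path_conn F \<alpha> r v)"

end

theory Submission
  imports Defs
begin

text \<open>
  Both trails and paths from \<open>r\<close> are regular paths in a skew-symmetric graph: for trails the states
  are the oriented edges, the mate of a state being the reversed edge, and for paths they are the pairs
  of a vertex and the sign with which it is entered, the mate having the opposite sign. Edmonds' blossom
  algorithm describes what is reachable. Applied to trails, it partitions the trail-undirectable edges
  into blossoms, each of which is entered by a single oriented edge, and by edge-cleanness \<open>r\<close> lies in
  none of them; contracting the blossoms turns the remaining edges that lie on \<open>r\<close>-paths into a digraph
  in which edge-disjoint paths from \<open>r\<close> correspond to edge-disjoint \<open>r\<close>-paths of the bidirected graph.
  Applied to paths, it yields a set \<open>M\<close> of at most as many edges as there are path-reachable pairs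
  that preserves path-reachability. The flame consists of a minimal subgraph of the digraph with the
  same minimum cuts, which by submodularity is a flame as in Lovasz' theorem, together with the
  edges of \<open>M\<close> inside the blossoms.
\<close>

section \<open>Regular reachability in skew-symmetric graphs\<close>

text \<open>The edge that enters a blossom limits it to connectivity at most one for each vertex
  inside and each sign, so within a blossom only path-reachability has to survive, and
  \<open>M\<close> provides that. A blossom around the source would have no such edge; this is where
  edge-cleanness is used. Outside the blossoms all arcs entering a vertex have the same sign there,
  so cuts, which ignore signs, measure the connectivity. The obstacle is the count. The pairs at
  vertices outside the blossoms already pay for the digraph, so only the pairs inside may pay for
  the kept part of \<open>M\<close> and for the arcs entering blossoms. It must therefore be shown
  that \<open>M\<close> wastes at least one directed edge on each pair outside and contains every
  kept arc that enters a blossom. This needs an exact bound on \<open>M\<close>, which is why the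
  blossom algorithm carries \<open>card M < card R\<close>: each stage adds one label and at least
  one state. Labels are edges for paths, and trivial for trails, where nothing is counted.\<close>

locale skew_symmetric =
  fixes X :: "'a set" and mate :: "'a \<Rightarrow> 'a" and step :: "'l \<Rightarrow> 'a \<Rightarrow> 'a \<Rightarrow> bool" and s :: 'a
  assumes finite_states: "finite X" and source_in: "s \<in> X"
    and mate_mate [simp]: "mate (mate x) = x" and mate_neq: "x \<in> X \<Longrightarrow> mate x \<noteq> x"
    and step_in: "step e x y \<Longrightarrow> y \<in> X"
    and step_mate: "step e x y \<Longrightarrow> step e (mate y) (mate x)"
    and step_neq: "step e x y \<Longrightarrow> y \<noteq> mate x"
    and mate_in: "x \<in> X \<Longrightarrow> mate x \<in> X"
begin

text \<open>Regular paths, remembered only by the set of visited states, so that concatenation is a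
  union and reversal an image. \<open>A\<close> restricts which labels occur; a label may occur
  repeatedly.\<close>

inductive reach :: "'l set \<Rightarrow> 'a \<Rightarrow> 'a set \<Rightarrow> 'a \<Rightarrow> bool" for A a where
  refl: "reach A a {a} a"
| step: "reach A a (insert y Y) y" if "reach A a Y x" "e \<in> A" "step e x y" "y \<notin> Y" "mate y \<notin> Y"

lemma mate_image_iff: "x \<in> mate ` Y \<longleftrightarrow> mate x \<in> Y"
  by (metis image_iff mate_mate)

lemma reach_mono: "reach A a Y x \<Longrightarrow> A \<subseteq> A' \<Longrightarrow> reach A' a Y x"
  by (induction rule: reach.induct) (auto intro: reach.intros)

lemma reach_endpoints: "reach A a Y x \<Longrightarrow> a \<in> Y \<and> x \<in> Y"
  by (induction rule: reach.induct) auto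

lemma reach_append:
  assumes "reach A y Z z" "reach A a Y x" "e \<in> A" "step e x y" "Y \<inter> Z = {}" "Y \<inter> mate ` Z = {}"
  shows "reach A a (Y \<union> Z) z"
  using assms
proof (induction rule: reach.induct)
  case refl
  have "reach A a (insert y Y) y"
    by (rule reach.step[OF refl(1-3)]) (use refl in auto)
  then show ?case by simp
next
  case (step Z z f w)
  have "reach A a (insert w (Y \<union> Z)) w"
  proof (rule reach.step)
    show "reach A a (Y \<union> Z) z" using step by auto
    show "mate w \<notin> Y \<union> Z" using step by (auto simp: mate_image_iff disjoint_iff)
  qed (use step in auto)
  then show ?case by simp
qed

text \<open>Skew symmetry turns every step around. This is how a merge will reach the mates of
  states on a tree path.\<close>

lemma reach_reverse: "reach A a Y x \<Longrightarrow> reach A (mate x) (mate ` Y) (mate a)"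
proof (induction rule: reach.induct)
  case refl
  show ?case by (simp add: reach.refl)
next
  case (step Y x e y)
  have "reach A (mate y) ({mate y} \<union> mate ` Y) (mate a)"
    using step by (intro reach_append[OF step.IH reach.refl, of e])
      (auto simp: mate_image_iff step_mate)
  then show ?case by simp
qed

lemma reach_first_step:
  "reach A a Y x \<Longrightarrow> x = a \<or> (\<exists>y\<in>Y. \<exists>e\<in>A. step e a y \<and> y \<noteq> a)"
  by (induction rule: reach.induct) (auto dest: reach_endpoints)

text \<open>The state of Edmonds' blossom algorithm: \<open>R\<close> are the outer nodes found so far, \<open>bas\<close> maps
  each of them to the base of its blossom, \<open>rk\<close> is the height in the alternating tree of
  contracted blossoms, and \<open>M\<close> are the labels used.\<close>

definition blossoms :: "'a set \<Rightarrow> ('a \<Rightarrow> 'a) \<Rightarrow> ('a \<Rightarrow> nat) \<Rightarrow> 'l set \<Rightarrow> bool" where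
  "blossoms R bas rk M \<longleftrightarrow> s \<in> R \<and> mate s \<notin> R \<and> R \<subseteq> X \<and> finite M \<and> card M < card R \<and>
    (\<forall>x\<in>R. bas x \<in> R \<and> mate (bas x) \<notin> R \<and> (mate x \<notin> R \<longrightarrow> bas x = x) \<and>
      (mate x \<in> R \<longrightarrow> bas (mate x) = bas x) \<and>
      (\<exists>Y. reach M (bas x) Y x \<and> Y \<subseteq> {y\<in>R. bas y = bas x})) \<and>
    (\<forall>b\<in>R. mate b \<notin> R \<longrightarrow> b \<noteq> s \<longrightarrow> (\<exists>p\<in>R. \<exists>e\<in>M. step e p b \<and> rk (bas p) < rk b))"

text \<open>Only bases are related, so this is the tree after contraction. A base may have several
  parents; the later arguments use nothing but ancestry and the strict growth of
  \<open>rk\<close>.\<close>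

definition parent :: "'a set \<Rightarrow> ('a \<Rightarrow> 'a) \<Rightarrow> ('a \<Rightarrow> nat) \<Rightarrow> 'l set \<Rightarrow> ('a \<times> 'a) set" where
  "parent R bas rk M =
    {(bas p, b) | p b. p \<in> R \<and> b \<in> R \<and> mate b \<notin> R \<and> rk (bas p) < rk b \<and> (\<exists>e\<in>M. step e p b)}"

lemma parent_rank: "(a, b) \<in> (parent R bas rk M)\<^sup>* \<Longrightarrow> a = b \<or> rk a < rk b"
  by (induction rule: rtrancl_induct) (auto simp: parent_def)

lemma source_ancestor:
  assumes B: "blossoms R bas rk M" and b: "b \<in> R" "mate b \<notin> R"
  shows "(s, b) \<in> (parent R bas rk M)\<^sup>*"
  using b
proof (induction "rk b" arbitrary: b rule: less_induct)
  case less
  show ?case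
  proof (cases "b = s")
    case False
    then obtain p e where p: "p \<in> R" "e \<in> M" "step e p b" "rk (bas p) < rk b"
      using B less.prems unfolding blossoms_def by blast
    then have "(bas p, b) \<in> parent R bas rk M"
      using less.prems unfolding parent_def by blast
    moreover have "(s, bas p) \<in> (parent R bas rk M)\<^sup>*"
      using less.hyps[of "bas p"] p B unfolding blossoms_def by blast
    ultimately show ?thesis by (rule rtrancl_into_rtrancl[rotated])
  qed simp
qed

text \<open>The pieces inside successive blossoms concatenate to a regular path: ranks grow along
  \<open>parent\<close>, so the blossoms are distinct, and mates that both lie in \<open>R\<close>
  share a base.\<close>

lemma trunk:
  assumes B: "blossoms R bas rk M" and "(a, b) \<in> (parent R bas rk M)\<^sup>*"
    and "x \<in> R" "bas x = b"
  shows "\<exists>Y. reach M a Y x \<and>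
    Y \<subseteq> {y\<in>R. (a, bas y) \<in> (parent R bas rk M)\<^sup>* \<and> (bas y, b) \<in> (parent R bas rk M)\<^sup>*}"
  using assms(2-)
proof (induction arbitrary: x rule: rtrancl_induct)
  case base
  then obtain Y where "reach M a Y x" "Y \<subseteq> {y\<in>R. bas y = a}"
    using B unfolding blossoms_def by blast
  then show ?case by (intro exI[of _ Y]) auto
next
  case (step b' b)
  then obtain p e where p: "p \<in> R" "bas p = b'" "b \<in> R" "mate b \<notin> R" "rk b' < rk b"
      "e \<in> M" "step e p b"
    unfolding parent_def by blast
  obtain Y where Y: "reach M a Y p" "Y \<subseteq> {y\<in>R. (a, bas y) \<in> (parent R bas rk M)\<^sup>* \<and>
      (bas y, b') \<in> (parent R bas rk M)\<^sup>*}"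
    using step.IH[OF p(1,2)] by blast
  obtain Z where Z: "reach M b Z x" "Z \<subseteq> {y\<in>R. bas y = b}"
    using B step.prems unfolding blossoms_def by blast
  have bas_Y: "bas y \<noteq> b" "y \<in> R" if "y \<in> Y" for y
    using parent_rank[of "bas y" b' R bas rk M] Y(2) that p(5) by auto
  have "Y \<inter> Z = {}" using bas_Y Z(2) by blast
  moreover have "Y \<inter> mate ` Z = {}"
  proof -
    have False if y: "y \<in> Y" "mate y \<in> Z" for y
    proof -
      have "bas (mate y) = bas y"
        using B bas_Y(2)[OF y(1)] y(2) Z(2) unfolding blossoms_def by blast
      then show False using bas_Y(1)[OF y(1)] y(2) Z(2) by auto
    qed
    then show ?thesis by (auto simp: mate_image_iff disjoint_iff)
  qed
  ultimately have "reach M a (Y \<union> Z) x"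
    by (rule reach_append[OF Z(1) Y(1) p(6,7)])
  moreover have "(a, b) \<in> (parent R bas rk M)\<^sup>*"
    using step.hyps by (rule rtrancl_into_rtrancl)
  moreover have "(bas y, b) \<in> (parent R bas rk M)\<^sup>*" if "y \<in> Y" for y
    using Y(2) that step.hyps(2) by (blast intro: rtrancl_into_rtrancl)
  ultimately show ?case using Y(2) Z(2) by (intro exI[of _ "Y \<union> Z"]) auto
qed

text \<open>\<open>y\<close> becomes a blossom of its own; this one new state pays for the label
  \<open>e\<close>.\<close>

lemma blossoms_grow:
  assumes B: "blossoms R bas rk M" and p: "p \<in> R" "step e p y" and y: "y \<notin> R" "mate y \<notin> R"
  shows "\<exists>R' bas' rk' M'. blossoms R' bas' rk' M' \<and> card R < card R'"
proof -
  let ?R = "insert y R" and ?bas = "bas(y := y)" and ?rk = "rk(y := Suc (rk (bas p)))"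
    and ?M = "insert e M"
  note B' = B[unfolded blossoms_def]
  have fin: "finite R" using B' finite_states finite_subset by blast
  have y_mate: "mate y \<noteq> y" "y \<noteq> mate y" using mate_neq[OF step_in[OF p(2)]] by simp_all
  have my: "mate x \<noteq> y" if "x \<in> R" for x using that y(2) by auto
  have yb: "bas x \<noteq> y" if "x \<in> R" for x using that y(1) B' by metis
  have ne: "x \<noteq> y" if "x \<in> R" for x using that y(1) by metis
  have "blossoms ?R ?bas ?rk ?M"
    unfolding blossoms_def
  proof (intro conjI ballI impI)
    show "s \<in> ?R" "mate s \<notin> ?R" "?R \<subseteq> X" "finite ?M"
      using B' my step_in[OF p(2)] by auto
    show "card ?M < card ?R"
      using B' fin y(1) card_insert_le_m1 by (auto simp: card_insert_if)
  next
    fix x assume x: "x \<in> ?R"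
    show "?bas x \<in> ?R" using x B' y_mate by auto
    show "mate (?bas x) \<notin> ?R" using x B' y my y_mate by auto
    show "mate x \<notin> ?R \<Longrightarrow> ?bas x = x" using x B' y_mate by auto
    show "mate x \<in> ?R \<Longrightarrow> ?bas (mate x) = ?bas x"
      using x B' my y y_mate by auto
    show "\<exists>Y. reach ?M (?bas x) Y x \<and> Y \<subseteq> {z \<in> ?R. ?bas z = ?bas x}"
    proof (cases "x = y")
      case True
      then show ?thesis by (intro exI[of _ "{y}"]) (auto intro: reach.refl)
    next
      case False
      then have "x \<in> R" using x by simp
      then obtain Y where "reach M (bas x) Y x" "Y \<subseteq> {z\<in>R. bas z = bas x}"
        using B' by blast
      then show ?thesis using False ne by (intro exI[of _ Y]) (auto intro: reach_mono)
    qed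
  next
    fix b assume b: "b \<in> ?R" "mate b \<notin> ?R" "b \<noteq> s"
    show "\<exists>p\<in>?R. \<exists>e\<in>?M. step e p b \<and> ?rk (?bas p) < ?rk b"
    proof (cases "b = y")
      case True
      then show ?thesis using p ne[OF p(1)] yb[OF p(1)]
        by (intro bexI[of _ p] bexI[of _ e]) auto
    next
      case False
      then obtain p' e' where "p' \<in> R" "e' \<in> M" "step e' p' b" "rk (bas p') < rk b"
        using B' b by blast
      then show ?thesis using False ne yb
        by (intro bexI[of _ p'] bexI[of _ e']) auto
    qed
  qed
  moreover have "card R < card ?R" using fin y(1) by (simp add: card_insert_if)
  ultimately show ?thesis by blast
qed

text \<open>By skew symmetry the step also leads from \<open>q\<close> to \<open>mate p\<close>, so
  it closes a cycle of blossoms. Going round it in either direction reaches the mates of the bases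
  on the far side, and at least one such new state pays for \<open>e\<close>.\<close>

lemma blossoms_merge:
  assumes B: "blossoms R bas rk M" and p: "p \<in> R" "q \<in> R" "step e p (mate q)"
    and ne: "bas p \<noteq> bas q"
  shows "\<exists>R' bas' rk' M'. blossoms R' bas' rk' M' \<and> card R < card R'"
proof -
  note B' = B[unfolded blossoms_def]
  have basic: "s \<in> R" "mate s \<notin> R" "R \<subseteq> X" "finite M" "card M < card R" using B' by simp_all
  have fin: "finite R" using basic(3) finite_states finite_subset by blast
  define anc where "anc a b \<longleftrightarrow> (a, b) \<in> (parent R bas rk M)\<^sup>*" for a b
  have anc_refl: "anc a a" for a by (simp add: anc_def)
  have anc_trans: "anc a b \<Longrightarrow> anc b c \<Longrightarrow> anc a c" for a b c
    unfolding anc_def by (rule rtrancl_trans)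
  have anc_rank: "anc a b \<Longrightarrow> a = b \<or> rk a < rk b" for a b
    unfolding anc_def by (rule parent_rank)
  have bas_base: "bas x \<in> R" "mate (bas x) \<notin> R" "bas (bas x) = bas x" if "x \<in> R" for x
    using B' that by blast+
  have anc_base: "a \<in> R \<and> mate a \<notin> R" if "anc a b" "b \<in> R" "mate b \<notin> R" for a b
    using that unfolding anc_def
    by (induction rule: converse_rtrancl_induct) (auto simp: parent_def bas_base)
  have src: "anc s (bas x)" if "x \<in> R" for x
    using source_ancestor[OF B] bas_base that unfolding anc_def by blast
  define A where "A = {a. anc a (bas p) \<and> anc a (bas q)}"
  have "A \<subseteq> R" using anc_base bas_base p(1) unfolding A_def by blast
  then have "finite A" using fin finite_subset by blast
  moreover have "s \<in> A" using src p unfolding A_def by blast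
  ultimately have "Max (rk ` A) \<in> rk ` A" and max: "\<And>a. a \<in> A \<Longrightarrow> rk a \<le> Max (rk ` A)"
    by (auto intro!: Max_in)
  then obtain c where c: "c \<in> A" "\<And>a. a \<in> A \<Longrightarrow> rk a \<le> rk c"
    by (metis (lifting) imageE)
  have bas_self: "bas x = x" if "x \<in> R" "mate x \<notin> R" for x
    using B' that by simp
  have c_base: "c \<in> R" "mate c \<notin> R"
    using anc_base[of c "bas p"] bas_base(1,2)[OF p(1)] c(1) by (simp_all add: A_def)
  then have bas_c: "bas c = c" by (rule bas_self)
  \<comment> \<open>\<open>c\<close>, a common ancestor of largest rank, becomes the base of the
    merged blossom. \<open>V x\<close> collects every base below \<open>c\<close> on the way to
    \<open>bas x\<close>, possibly on several chains; the choice of \<open>c\<close> still keeps the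
    two sides disjoint.\<close>
  define V where "V x = {d. d \<noteq> c \<and> anc c d \<and> anc d (bas x)}" for x
  have disj: "V p \<inter> V q = {}"
  proof -
    have False if "d \<in> V p" "d \<in> V q" for d
    proof -
      have "d \<in> A" "d \<noteq> c" "anc c d" using that by (auto simp: V_def A_def)
      then show False using c(2)[of d] anc_rank[of c d] by auto
    qed
    then show ?thesis by blast
  qed
  define N where "N = V p \<union> V q"
  have N_base: "d \<in> R" "mate d \<notin> R" "bas d = d" if "d \<in> N" for d
  proof -
    have "anc d (bas p) \<or> anc d (bas q)" using that by (auto simp: N_def V_def)
    then show "d \<in> R" "mate d \<notin> R"
      using anc_base[of d] bas_base(1,2)[OF p(1)] bas_base(1,2)[OF p(2)] by blast+
    then show "bas d = d" by (rule bas_self)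
  qed
  have c_N: "c \<notin> N" unfolding N_def V_def by blast
  have N_rank: "rk c < rk d" if "d \<in> N" for d
    using that anc_rank[of c d] by (auto simp: N_def V_def)
  have "N \<noteq> {}"
    using ne c(1) anc_refl by (auto simp: N_def V_def A_def)
  have mN: "mate ` N \<inter> R = {}" using N_base(2) by blast
  \<comment> \<open>The only new states are the mates of \<open>N\<close>: a state that is not its
    own base already has its mate in \<open>R\<close>.\<close>
  define bas' where "bas' x = (if x \<in> mate ` N \<or> bas x \<in> N then c else bas x)" for x
  let ?R = "R \<union> mate ` N" and ?M = "insert e M"
  have bas'_R: "bas' x = (if bas x \<in> N then c else bas x)" if "x \<in> R" for x
    using that mN unfolding bas'_def by auto
  have bas'_N: "bas' x = c" if "x \<in> mate ` N" for x
    using that unfolding bas'_def by auto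
  have bas_mate: "bas (mate x) = bas x" if "x \<in> R" "mate x \<in> R" for x
    using B' that by blast
  have trunk': "\<exists>Y. reach M a Y x \<and> Y \<subseteq> {y\<in>R. anc a (bas y) \<and> anc (bas y) (bas x)}"
    if "anc a (bas x)" "x \<in> R" for a x
    using trunk[OF B] that unfolding anc_def by blast
  \<comment> \<open>The route to \<open>mate d\<close>: the trunk from \<open>c\<close> to
    \<open>u\<close>, then \<open>e\<close>, then the trunk from \<open>d\<close> to
    \<open>v\<close> traversed backwards through mates. Leaving \<open>u\<close>, \<open>v\<close>
    general covers both directions round the cycle.\<close>
  have opposite_side: "\<exists>Y. reach ?M c Y (mate d) \<and> Y \<subseteq> {y\<in>?R. bas' y = c}"
    if uv: "u \<in> R" "v \<in> R" "step e u (mate v)" "{u, v} = {p, q}" and d: "d \<in> V v" for u v d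
  proof -
    have cu: "anc c (bas u)" and UV: "V u \<inter> V v = {}" "V u \<subseteq> N" "V v \<subseteq> N"
      using c(1) uv(4) disj unfolding A_def N_def by (auto simp: doubleton_eq_iff)
    obtain Y1 where Y1: "reach M c Y1 u" "Y1 \<subseteq> {y\<in>R. anc c (bas y) \<and> anc (bas y) (bas u)}"
      using trunk'[OF cu uv(1)] by blast
    obtain Y2 where Y2: "reach M d Y2 v" "Y2 \<subseteq> {y\<in>R. anc d (bas y) \<and> anc (bas y) (bas v)}"
      using trunk'[of d v] d uv(2) unfolding V_def by blast
    have Y1': "y \<in> R \<and> bas y \<in> insert c (V u)" if "y \<in> Y1" for y
      using Y1(2) that unfolding V_def by blast
    have Y2': "y \<in> R \<and> bas y \<in> V v" if "y \<in> Y2" for y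
    proof -
      have y: "y \<in> R" "anc d (bas y)" "anc (bas y) (bas v)" using Y2(2) that by blast+
      have "bas y \<noteq> c" using anc_rank[OF y(2)] N_rank[of d] d UV(3) c_N by force
      then show ?thesis using y d anc_trans unfolding V_def by blast
    qed
    have cV: "c \<notin> V v" unfolding V_def by blast
    have "reach ?M c (Y1 \<union> mate ` Y2) (mate d)"
    proof (rule reach_append)
      show "reach ?M (mate v) (mate ` Y2) (mate d)"
        using reach_reverse[OF Y2(1)] by (rule reach_mono) blast
      show "reach ?M c Y1 u" using Y1(1) by (rule reach_mono) blast
      show "step e u (mate v)" by fact
      have "bas y \<noteq> bas z" if "y \<in> Y1" "z \<in> Y2" for y z
        using Y1'[OF that(1)] Y2'[OF that(2)] UV(1) cV by auto
      then show "Y1 \<inter> mate ` mate ` Y2 = {}" "Y1 \<inter> mate ` Y2 = {}"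
        using Y1' Y2' bas_mate by (fastforce simp: image_image)+
    qed simp
    moreover have "y \<in> ?R \<and> bas' y = c" if "y \<in> Y1" for y
      using Y1'[OF that] UV(2) bas'_R by auto
    moreover have "mate y \<in> ?R \<and> bas' (mate y) = c" if "y \<in> Y2" for y
    proof (cases "mate y \<in> R")
      case True
      then show ?thesis using Y2'[OF that] UV(3) bas'_R bas_mate by auto
    next
      case False
      then have "y \<in> N" using Y2'[OF that] bas_self[of y] UV(3) by auto
      then show ?thesis using bas'_N by auto
    qed
    ultimately show ?thesis by (intro exI[of _ "Y1 \<union> mate ` Y2"]) auto
  qed
  have card_less: "card R < card ?R"
  proof (rule psubset_card_mono)
    have "N \<subseteq> R" using N_base(1) by blast
    then show "finite ?R" using fin finite_subset by blast
    show "R \<subset> ?R" using mN \<open>N \<noteq> {}\<close> by blast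
  qed
  have mq: "step e q (mate p)" using step_mate[OF p(3)] by simp
  have "blossoms ?R bas' rk ?M"
    unfolding blossoms_def
  proof (intro conjI ballI impI)
    have "s \<notin> N"
    proof
      assume "s \<in> N"
      then show False using N_rank[of s] anc_rank[of s c] src[OF c_base(1)] bas_c by simp
    qed
    then show "mate s \<notin> ?R" "s \<in> ?R" using basic(1,2) by (auto simp: mate_image_iff)
    show "?R \<subseteq> X" using basic(3) N_base(1) by (auto intro: mate_in)
    show "finite ?M" using basic(4) by simp
    show "card ?M < card ?R" using basic(4,5) card_less by (simp add: card_insert_if)
  next
    fix x assume x: "x \<in> ?R"
    have bb: "(bas' x = c \<or> x \<in> R \<and> bas' x = bas x) \<and> bas' x \<notin> N"
      using x bas'_R[of x] bas'_N[of x] c_N by (auto split: if_splits)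
    then show "bas' x \<in> ?R" using bas_base c_base by auto
    show "mate (bas' x) \<notin> ?R" using bb bas_base c_base by (auto simp: mate_image_iff)
    show "bas' x = x" if "mate x \<notin> ?R"
      using that x N_base bas'_R[of x] bas_self[of x] by (auto simp: mate_image_iff)
    show "bas' (mate x) = bas' x" if "mate x \<in> ?R"
      using that x N_base bas'_R bas'_N bas_mate by (auto simp: mate_image_iff)
    show "\<exists>Y. reach ?M (bas' x) Y x \<and> Y \<subseteq> {y \<in> ?R. bas' y = bas' x}"
    proof (cases "x \<in> R")
      case xR: True
      show ?thesis
      proof (cases "bas x \<in> insert c N")
        case True
        then have *: "anc c (bas x)" "bas' x = c"
          using anc_refl bas'_R[OF xR] unfolding N_def V_def by auto
        obtain Y where Y: "reach M c Y x" "Y \<subseteq> {y\<in>R. anc c (bas y) \<and> anc (bas y) (bas x)}"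
          using trunk'[OF *(1) xR] by blast
        have "y \<in> ?R \<and> bas' y = c" if "y \<in> Y" for y
        proof -
          have y: "y \<in> R" "anc c (bas y)" "anc (bas y) (bas x)" using Y(2) that by blast+
          have "bas y \<in> insert c N"
          proof (cases "bas x = c")
            case True
            then have "bas y = c" using anc_rank[OF y(2)] anc_rank[OF y(3)] by auto
            then show ?thesis by simp
          next
            case False
            then have "anc (bas x) (bas p) \<or> anc (bas x) (bas q)"
              using \<open>bas x \<in> insert c N\<close> by (auto simp: N_def V_def)
            then have "anc (bas y) (bas p) \<or> anc (bas y) (bas q)"
              using anc_trans[OF y(3)] by blast
            then show ?thesis using y(2) by (auto simp: N_def V_def)
          qed
          then show ?thesis using y(1) bas'_R[OF y(1)] bas_c by auto
        qed
        then have "Y \<subseteq> {y \<in> ?R. bas' y = bas' x}" using *(2) by blast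
        moreover have "reach ?M (bas' x) Y x" using Y(1) unfolding *(2) by (rule reach_mono) blast
        ultimately show ?thesis by blast
      next
        case False
        then have bx: "bas' x = bas x" using bas'_R[OF xR] by auto
        obtain Y where Y: "reach M (bas x) Y x" "Y \<subseteq> {y\<in>R. bas y = bas x}"
          using B' xR by blast
        then have "Y \<subseteq> {y \<in> ?R. bas' y = bas' x}" using bx False bas'_R by auto
        moreover have "reach ?M (bas' x) Y x" using Y(1) unfolding bx by (rule reach_mono) blast
        ultimately show ?thesis by blast
      qed
    next
      case False
      then obtain d where d: "d \<in> N" "x = mate d" using x by blast
      then show ?thesis
        using opposite_side[OF p(1,2,3), of d] opposite_side[OF p(2,1) mq, of d] bas'_N[of x]
        unfolding N_def by auto
    qed
  next
    fix b assume b: "b \<in> ?R" "mate b \<notin> ?R" "b \<noteq> s"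
    then have bR: "b \<in> R" "mate b \<notin> R" using N_base by (auto simp: mate_image_iff)
    then obtain p' e' where p': "p' \<in> R" "e' \<in> M" "step e' p' b" "rk (bas p') < rk b"
      using B' b(3) by blast
    \<comment> \<open>The base of a parent changes only to \<open>c\<close>, which ranks below all
      of \<open>N\<close>, so the old ranks stay valid.\<close>
    have "rk (bas' p') \<le> rk (bas p')"
      using bas'_R[OF p'(1)] N_rank by (auto intro: less_imp_le)
    then show "\<exists>p\<in>?R. \<exists>e\<in>?M. step e p b \<and> rk (bas' p) < rk b"
      using p' by (intro bexI[of _ p'] bexI[of _ e']) auto
  qed
  then show ?thesis using card_less by blast
qed

section \<open>Termination of the algorithm and the structure of the reachable states\<close>

definition closed_blossoms :: "'a set \<Rightarrow> ('a \<Rightarrow> 'a) \<Rightarrow> bool" where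
  "closed_blossoms R bas \<longleftrightarrow>
    (\<forall>p\<in>R. \<forall>e y. step e p y \<longrightarrow> y \<in> R \<or> mate y \<in> R) \<and>
    (\<forall>p\<in>R. \<forall>q\<in>R. \<forall>e. step e p (mate q) \<longrightarrow> bas p = bas q)"

lemma closed_blossoms_exist: "\<exists>R bas rk M. blossoms R bas rk M \<and> closed_blossoms R bas"
proof -
  define P where "P n \<longleftrightarrow> (\<exists>R bas rk M. blossoms R bas rk M \<and> card R = n)" for n
  have "blossoms {s} (\<lambda>_. s) (\<lambda>_. 0) {}"
    unfolding blossoms_def using source_in mate_neq[OF source_in] reach.refl by auto
  then have "P 1" unfolding P_def by (metis One_nat_def card.empty card.insert empty_iff finite.emptyI)
  moreover have "n \<le> card X" if "P n" for n
    using that card_mono[OF finite_states] unfolding P_def blossoms_def by blast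
  ultimately obtain n where n: "P n" "\<And>m. P m \<Longrightarrow> m \<le> n"
    using GreatestI_nat[of P 1 "card X"] Greatest_le_nat[of P _ "card X"] by blast
  then obtain R bas rk M where B: "blossoms R bas rk M" "card R = n" unfolding P_def by blast
  have max: "\<not> (\<exists>R' bas' rk' M'. blossoms R' bas' rk' M' \<and> card R < card R')"
    using n(2) B(2) unfolding P_def by (metis not_le)
  have "closed_blossoms R bas"
    unfolding closed_blossoms_def using max blossoms_grow[OF B(1)] blossoms_merge[OF B(1)] by blast
  then show ?thesis using B(1) by blast
qed

text \<open>That a path contains the bases of its states is what drives the induction. If the path
  left \<open>R\<close> by stepping to \<open>y\<close>, then \<open>mate y\<close> would be its own
  base and the base of the previous state, hence already visited, against regularity.\<close>

lemma reach_closed: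
  assumes B: "blossoms R bas rk M" and C: "closed_blossoms R bas" and "reach A s Y x"
  shows "Y \<subseteq> R \<and> bas ` Y \<subseteq> Y"
  using assms(3)
proof (induction rule: reach.induct)
  case refl
  then show ?case using B unfolding blossoms_def by auto
next
  case (step Y x e y)
  note B' = B[unfolded blossoms_def] and C' = C[unfolded closed_blossoms_def]
  have x: "x \<in> R" "bas x \<in> Y" using step.IH reach_endpoints[OF step.hyps(1)] by auto
  have *: "bas x = bas (mate y)" if "mate y \<in> R"
    using C' x(1) step.hyps(3) that by (metis mate_mate)
  have y: "y \<in> R"
  proof (rule ccontr)
    assume "y \<notin> R"
    then have "mate y \<in> R" using C' x(1) step.hyps(3) by blast
    moreover from this have "bas (mate y) = mate y" using B' \<open>y \<notin> R\<close> by simp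
    ultimately show False using * x(2) step.hyps(5) by simp
  qed
  have "bas y \<in> insert y Y"
    using B' y * x(2) by (cases "mate y \<in> R") auto
  then show ?case using step.IH y by auto
qed

theorem blossom_structure:
  obtains R bas M where "R = {x. \<exists>Y. reach UNIV s Y x}" "R = {x. \<exists>Y. reach M s Y x}"
    "finite M" "card M < card R" "R \<subseteq> X" "mate s \<notin> R"
    "\<And>x. x \<in> R \<Longrightarrow> bas x \<in> R" "\<And>x. x \<in> R \<Longrightarrow> mate (bas x) \<notin> R"
    "\<And>x. x \<in> R \<Longrightarrow> mate x \<notin> R \<Longrightarrow> bas x = x"
    "\<And>x. x \<in> R \<Longrightarrow> mate x \<in> R \<Longrightarrow> bas (mate x) = bas x"
    "\<And>x. x \<in> R \<Longrightarrow> \<exists>Y. reach UNIV (bas x) Y x \<and> Y \<subseteq> {y\<in>R. bas y = bas x}"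
    "\<And>p e y. p \<in> R \<Longrightarrow> step e p y \<Longrightarrow> y \<in> R \<or> mate y \<in> R"
    "\<And>p q e. p \<in> R \<Longrightarrow> q \<in> R \<Longrightarrow> step e p (mate q) \<Longrightarrow> bas p = bas q"
    "\<And>Y x. reach UNIV s Y x \<Longrightarrow> bas ` Y \<subseteq> Y"
proof -
  obtain R bas rk M where B: "blossoms R bas rk M" and C: "closed_blossoms R bas"
    using closed_blossoms_exist by blast
  note B' = B[unfolded blossoms_def]
  have 1: "\<exists>Y. reach M s Y x" if "x \<in> R" for x
  proof -
    have "bas x \<in> R" "mate (bas x) \<notin> R" using B' that by auto
    then show ?thesis using trunk[OF B source_ancestor[OF B] that HOL.refl] by blast
  qed
  have 2: "x \<in> R" if "reach A s Y x" for A Y x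
    using reach_closed[OF B C that] reach_endpoints[OF that] by blast
  show thesis
  proof (rule that[of R M bas])
    show "R = {x. \<exists>Y. reach UNIV s Y x}" "R = {x. \<exists>Y. reach M s Y x}"
      using 1 2 reach_mono[of M s _ _ UNIV] by blast+
    show "\<exists>Y. reach UNIV (bas x) Y x \<and> Y \<subseteq> {y\<in>R. bas y = bas x}" if "x \<in> R" for x
      using B' that reach_mono[of M "bas x" _ x UNIV] by blast
    show "bas p = bas q" if "p \<in> R" "q \<in> R" "step e p (mate q)" for p q e
      using C that unfolding closed_blossoms_def by blast
    show "y \<in> R \<or> mate y \<in> R" if "p \<in> R" "step e p y" for p e y
      using C that unfolding closed_blossoms_def by blast
    show "bas ` Y \<subseteq> Y" if "reach UNIV s Y x" for Y x
      using reach_closed[OF B C that] by blast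
  qed (use B' in auto)
qed

corollary few_labels_reach_all:
  obtains R M where "R = {x. \<exists>Y. reach UNIV s Y x}" "R = {x. \<exists>Y. reach M s Y x}"
    "finite M" "card M < card R" "R \<subseteq> X" "mate s \<notin> R"
  by (rule blossom_structure) (rule that)

end

section \<open>Cuts, flows and flames in digraphs\<close>

locale digraph =
  fixes src tgt :: "'e \<Rightarrow> 'n" and r :: 'n
begin

definition indeg :: "'e set \<Rightarrow> 'n set \<Rightarrow> nat" where
  "indeg E X = card {e\<in>E. src e \<notin> X \<and> tgt e \<in> X}"

definition cuts :: "'n \<Rightarrow> 'n set set" where
  "cuts v = {X. r \<notin> X \<and> v \<in> X}"

text \<open>Meaningful for \<open>v \<noteq> r\<close> only, since \<open>cuts r\<close> is
  empty.\<close>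

definition mincut :: "'e set \<Rightarrow> 'n \<Rightarrow> nat" where
  "mincut E v = (INF X\<in>cuts v. indeg E X)"

lemma mincut_le: "X \<in> cuts v \<Longrightarrow> mincut E v \<le> indeg E X"
  unfolding mincut_def by (rule cINF_lower) auto

lemma mincut_attained:
  assumes "v \<noteq> r" obtains X where "X \<in> cuts v" "indeg E X = mincut E v"
proof -
  have "{v} \<in> cuts v" using assms unfolding cuts_def by auto
  then have "Inf (indeg E ` cuts v) \<in> indeg E ` cuts v"
    by (intro Inf_nat_def1) auto
  then show thesis using that unfolding mincut_def by auto
qed

lemma indeg_eq_sum:
  "finite E \<Longrightarrow> indeg E X = (\<Sum>e\<in>E. of_bool (src e \<notin> X \<and> tgt e \<in> X))"
  unfolding indeg_def by (subst sum_of_bool_eq) (auto simp: Collect_conj_eq)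

lemma indeg_submodular:
  assumes "finite E"
  shows "indeg E (X \<inter> Y) + indeg E (X \<union> Y) \<le> indeg E X + indeg E Y"
  unfolding indeg_eq_sum[OF assms] sum.distrib[symmetric]
  by (rule sum_mono) auto

lemma indeg_mono: "finite E \<Longrightarrow> F \<subseteq> E \<Longrightarrow> indeg F X \<le> indeg E X"
  unfolding indeg_def by (rule card_mono) auto

lemma mincut_mono:
  assumes "finite E" "F \<subseteq> E" "v \<noteq> r" shows "mincut F v \<le> mincut E v"
  by (metis assms indeg_mono mincut_attained mincut_le order_trans)

text \<open>In a smallest admissible \<open>F\<close> every edge enters a tight set, that is, a
  minimum cut of some vertex. Uncrossing yields one tight set of \<open>v\<close> that is entered by
  all edges with target \<open>v\<close>.\<close>

theorem cut_flame:
  assumes "finite E"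
  obtains F where "F \<subseteq> E" "\<And>v. v \<noteq> r \<Longrightarrow> mincut F v = mincut E v"
    "\<And>v. v \<noteq> r \<Longrightarrow> card {e\<in>F. tgt e = v} \<le> mincut F v"
proof -
  define ok where "ok F \<longleftrightarrow> F \<subseteq> E \<and> (\<forall>v. v \<noteq> r \<longrightarrow> mincut F v = mincut E v)" for F
  obtain F where F: "ok F" and min: "\<And>F'. ok F' \<Longrightarrow> card F \<le> card F'"
    using arg_min_nat_lemma[of ok E card] unfolding ok_def by auto
  have fin: "finite F" using F assms finite_subset unfolding ok_def by blast
  have critical: "\<exists>w X. w \<noteq> r \<and> X \<in> cuts w \<and> indeg F X = mincut F w \<and> src e \<notin> X \<and> tgt e \<in> X"
    if "e \<in> F" for e
  proof -
    have "\<not> ok (F - {e})"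
      using min[of "F - {e}"] that fin by (metis card_Diff1_less not_le)
    then obtain w where w: "w \<noteq> r" "mincut (F - {e}) w \<noteq> mincut F w"
      using F unfolding ok_def by auto
    have "mincut (F - {e}) w < mincut F w"
      using mincut_mono[OF fin, of "F - {e}" w] w by auto
    obtain X where X: "X \<in> cuts w" "indeg (F - {e}) X = mincut (F - {e}) w"
      using mincut_attained[OF w(1)] by blast
    have lt: "indeg (F - {e}) X < indeg F X"
      using X mincut_le[OF X(1), of F] \<open>mincut (F - {e}) w < mincut F w\<close> by simp
    have e: "src e \<notin> X \<and> tgt e \<in> X"
    proof (rule ccontr)
      assume "\<not> ?thesis"
      then have "{f\<in>F - {e}. src f \<notin> X \<and> tgt f \<in> X} = {f\<in>F. src f \<notin> X \<and> tgt f \<in> X}" by auto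
      then show False using lt unfolding indeg_def by simp
    qed
    have "{f\<in>F - {e}. src f \<notin> X \<and> tgt f \<in> X} = {f\<in>F. src f \<notin> X \<and> tgt f \<in> X} - {e}" by auto
    then have "indeg F X = Suc (indeg (F - {e}) X)"
      using e that fin unfolding indeg_def by (simp del: card_Diff_insert card_Diff_singleton add: card_Suc_Diff1)
    then have "indeg F X = mincut F w"
      using X mincut_le[OF X(1), of F] \<open>mincut (F - {e}) w < mincut F w\<close> by simp
    then show ?thesis using w(1) X(1) e by blast
  qed
  have "card {e\<in>F. tgt e = v} \<le> mincut F v" if v: "v \<noteq> r" for v
  proof -
    \<comment> \<open>The edges into \<open>v\<close> are handled one by one, intersecting the
      current tight set \<open>Y\<close> of \<open>v\<close> with a tight set \<open>X\<close> of
      some \<open>w\<close>. The union still separates \<open>w\<close> from \<open>r\<close>, so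
      submodularity forces equality in both cut bounds.\<close>
    have "\<exists>Y\<in>cuts v. indeg F Y = mincut F v \<and> (\<forall>e\<in>S. src e \<notin> Y)"
      if "finite S" "S \<subseteq> {e\<in>F. tgt e = v}" for S
      using that
    proof (induction S rule: finite_induct)
      case empty
      then show ?case using mincut_attained[OF v, of F] by auto
    next
      case (insert e S)
      then obtain Y where Y: "Y \<in> cuts v" "indeg F Y = mincut F v" "\<forall>e\<in>S. src e \<notin> Y" by auto
      obtain w X where X: "X \<in> cuts w" "indeg F X = mincut F w" "src e \<notin> X" "v \<in> X"
        using critical[of e] insert.prems by auto
      have c: "X \<inter> Y \<in> cuts v" "X \<union> Y \<in> cuts w" using X Y unfolding cuts_def by auto
      then have "indeg F (X \<inter> Y) = mincut F v"
        using indeg_submodular[OF fin, of X Y] mincut_le[OF c(1), of F] mincut_le[OF c(2), of F]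
          X(2) Y(2) by linarith
      then show ?case using c(1) X(3) Y(3) by auto
    qed
    from this[of "{e\<in>F. tgt e = v}"] obtain Y where Y: "Y \<in> cuts v" "indeg F Y = mincut F v"
        "\<forall>e\<in>{e\<in>F. tgt e = v}. src e \<notin> Y"
      using fin by auto
    have "card {e\<in>F. tgt e = v} \<le> indeg F Y"
      unfolding indeg_def using fin Y(1,3) by (intro card_mono) (auto simp: cuts_def)
    then show ?thesis using Y(2) by simp
  qed
  then show thesis using that F unfolding ok_def by blast
qed

section \<open>Integral flows and Menger's theorem\<close>

definition net :: "'e set \<Rightarrow> 'n set \<Rightarrow> int" where
  "net f X = (\<Sum>e\<in>f. of_bool (tgt e \<in> X) - of_bool (src e \<in> X))"

text \<open>Conservation is stated for vertex sets: singletons give the usual law, and the cut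
  arguments evaluate it at the complement of a reachable set.\<close>

definition flow :: "'e set \<Rightarrow> int \<Rightarrow> 'n \<Rightarrow> bool" where
  "flow f k t \<longleftrightarrow> (\<forall>X. net f X = k * (of_bool (t \<in> X) - of_bool (r \<in> X)))"

text \<open>\<open>augment E f V u g\<close>: rerouting the flow \<open>f\<close> along a residual path from \<open>r\<close> to \<open>u\<close> with vertex
  set \<open>V\<close> gives \<open>g\<close>.\<close>

inductive augment :: "'e set \<Rightarrow> 'e set \<Rightarrow> 'n set \<Rightarrow> 'n \<Rightarrow> 'e set \<Rightarrow> bool" for E f where
  start: "augment E f {r} r f"
| forward: "augment E f (insert (tgt e) V) (tgt e) (insert e g)"
    if "augment E f V (src e) g" "e \<in> E" "e \<notin> f" "tgt e \<notin> V"
| backward: "augment E f (insert (src e) V) (src e) (g - {e})"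
    if "augment E f V (tgt e) g" "e \<in> f" "src e \<notin> V"

text \<open>Edges not inside \<open>V\<close> are untouched, so an edge about to be added is absent
  from \<open>g\<close> and one about to be removed is present. The last conjunct covers a step back
  into \<open>V\<close>: its target is residually reachable already.\<close>

lemma augment_invariant:
  assumes "augment E f V u g" "f \<subseteq> E" "finite E"
  shows "g \<subseteq> E \<and> u \<in> V \<and> (\<forall>e. src e \<notin> V \<or> tgt e \<notin> V \<longrightarrow> (e \<in> g \<longleftrightarrow> e \<in> f)) \<and>
    (\<forall>X. net g X = net f X + of_bool (u \<in> X) - of_bool (r \<in> X)) \<and> (\<forall>w\<in>V. \<exists>V' g'. augment E f V' w g')"
  using assms
proof (induction rule: augment.induct)
  case start
  then show ?case by (auto intro: augment.start)
next
  case (forward V e g)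
  then have IH: "g \<subseteq> E" "src e \<in> V" "\<And>e. src e \<notin> V \<or> tgt e \<notin> V \<Longrightarrow> (e \<in> g \<longleftrightarrow> e \<in> f)"
    "\<And>X. net g X = net f X + of_bool (src e \<in> X) - of_bool (r \<in> X)"
    "\<And>w. w \<in> V \<Longrightarrow> \<exists>V' g'. augment E f V' w g'" by auto
  have "finite g" "e \<notin> g" using IH(1) forward finite_subset IH(3)[of e] by auto
  then have "net (insert e g) X = of_bool (tgt e \<in> X) - of_bool (src e \<in> X) + net g X" for X
    unfolding net_def by simp
  moreover have "augment E f (insert (tgt e) V) (tgt e) (insert e g)"
    by (rule augment.forward[OF forward.hyps])
  ultimately show ?case using IH forward.hyps by auto
next
  case (backward V e g)
  then have IH: "g \<subseteq> E" "tgt e \<in> V" "\<And>e. src e \<notin> V \<or> tgt e \<notin> V \<Longrightarrow> (e \<in> g \<longleftrightarrow> e \<in> f)"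
    "\<And>X. net g X = net f X + of_bool (tgt e \<in> X) - of_bool (r \<in> X)"
    "\<And>w. w \<in> V \<Longrightarrow> \<exists>V' g'. augment E f V' w g'" by auto
  have "finite g" "e \<in> g" using IH(1) backward finite_subset IH(3)[of e] by auto
  then have "net (g - {e}) X = net g X - (of_bool (tgt e \<in> X) - of_bool (src e \<in> X))" for X
    unfolding net_def by (simp add: sum_diff1)
  moreover have "augment E f (insert (src e) V) (src e) (g - {e})"
    by (rule augment.backward[OF backward.hyps])
  ultimately show ?case using IH backward.hyps by auto
qed

text \<open>If \<open>t\<close> is not residually reachable, the complement of the reachable set is
  left by no edge of \<open>f\<close>, and all edges of \<open>E\<close> entering it belong to
  \<open>f\<close>. It is then a cut with in-degree exactly \<open>k\<close>, too small for
  \<open>Suc k\<close>.\<close>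

lemma max_flow_min_cut:
  assumes fin: "finite E" and t: "t \<noteq> r" and cut: "\<And>X. X \<in> cuts t \<Longrightarrow> k \<le> indeg E X"
  shows "\<exists>f\<subseteq>E. flow f (int k) t"
  using cut
proof (induction k)
  case 0
  have "flow {} 0 t" unfolding flow_def net_def by simp
  then show ?case by auto
next
  case (Suc k)
  then obtain f where f: "f \<subseteq> E" "flow f (int k) t" using Suc_leD by blast
  define S where "S = {u. \<exists>V g. augment E f V u g}"
  note inv = augment_invariant[OF _ f(1) fin]
  have r: "r \<in> S" unfolding S_def using augment.start by blast
  show ?case
  proof (cases "t \<in> S")
    case True
    then obtain V g where g: "augment E f V t g" unfolding S_def by blast
    have "flow g (int (Suc k)) t"
      using inv[OF g] f(2) unfolding flow_def by (simp add: algebra_simps)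
    then show ?thesis using inv[OF g] by blast
  next
    case False
    have fwd: "tgt e \<in> S" if "e \<in> E" "e \<notin> f" "src e \<in> S" for e
    proof -
      obtain V g where g: "augment E f V (src e) g" using \<open>src e \<in> S\<close> unfolding S_def by blast
      show ?thesis using augment.forward[OF g that(1,2)] inv[OF g] unfolding S_def by blast
    qed
    have bwd: "src e \<in> S" if "e \<in> f" "tgt e \<in> S" for e
    proof -
      obtain V g where g: "augment E f V (tgt e) g" using \<open>tgt e \<in> S\<close> unfolding S_def by blast
      show ?thesis using augment.backward[OF g that(1)] inv[OF g] unfolding S_def by blast
    qed
    have finf: "finite f" using f(1) fin finite_subset by blast
    have "net f (- S) = (\<Sum>e\<in>f. of_bool (src e \<notin> - S \<and> tgt e \<in> - S))"
      unfolding net_def using bwd by (intro sum.cong) auto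
    also have "\<dots> = int (indeg f (- S))" unfolding indeg_eq_sum[OF finf] by simp
    also have "indeg f (- S) = indeg E (- S)"
      unfolding indeg_def using fwd f(1) by (intro arg_cong[where f = card]) auto
    finally have "int k = int (indeg E (- S))"
      using f(2) False r unfolding flow_def by simp
    then show ?thesis using Suc.prems[of "- S"] False r unfolding cuts_def by simp
  qed
qed

inductive dpath :: "'e set \<Rightarrow> 'e list \<Rightarrow> 'n \<Rightarrow> bool" for E where
  nil: "dpath E [] r"
| snoc: "dpath E (p @ [e]) (tgt e)"
    if "dpath E p (src e)" "e \<in> E" "tgt e \<notin> insert r (tgt ` set p)"

lemma dpath_props:
  "dpath E p u \<Longrightarrow> set p \<subseteq> E \<and> u \<in> insert r (tgt ` set p) \<and> distinct p \<and>
    (\<forall>w\<in>insert r (tgt ` set p). \<exists>q. dpath E q w) \<and>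
    (\<forall>X. net (set p) X = of_bool (u \<in> X) - of_bool (r \<in> X))"
proof (induction rule: dpath.induct)
  case nil
  then show ?case by (auto simp: net_def intro: dpath.nil)
next
  case (snoc p e)
  have "dpath E (p @ [e]) (tgt e)" by (rule dpath.snoc[OF snoc.hyps])
  moreover have "e \<notin> set p" using snoc.hyps by auto
  ultimately show ?case using snoc by (auto simp: net_def)
qed

lemma dpath_mono: "dpath E p u \<Longrightarrow> E \<subseteq> E' \<Longrightarrow> dpath E' p u"
  by (induction rule: dpath.induct) (auto intro: dpath.intros)

lemma dpath_last: "dpath E p u \<Longrightarrow> p \<noteq> [] \<Longrightarrow> tgt (last p) = u"
  by (induction rule: dpath.induct) auto

text \<open>No edge of \<open>f\<close> leaves the set reachable along \<open>f\<close>, so its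
  complement has net inflow at most 0 and cannot contain \<open>t\<close>. Removing a path to
  \<open>t\<close> lowers the flow value by one.\<close>

lemma flow_decompose:
  assumes "finite f" "flow f (int k) t" "t \<noteq> r"
  shows "\<exists>P. finite P \<and> card P = k \<and> (\<forall>p\<in>P. dpath f p t) \<and> pairwise (\<lambda>p q. set p \<inter> set q = {}) P"
  using assms
proof (induction k arbitrary: f)
  case 0
  then show ?case by (intro exI[of _ "{}"]) auto
next
  case (Suc k)
  define S where "S = {u. \<exists>p. dpath f p u}"
  have r: "r \<in> S" unfolding S_def using dpath.nil by blast
  have "tgt e \<in> S" if "e \<in> f" "src e \<in> S" for e
    using that dpath.snoc[of f _ e] dpath_props[of f] unfolding S_def by blast
  then have "net f (- S) \<le> 0" unfolding net_def by (intro sum_nonpos) auto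
  then have "t \<in> S" using Suc.prems(2) r unfolding flow_def by (cases "t \<in> S") auto
  then obtain p where p: "dpath f p t" unfolding S_def by blast
  note pp = dpath_props[OF p]
  have "net (f - set p) X = net f X - net (set p) X" for X
    unfolding net_def using pp Suc.prems(1) by (intro sum_diff) auto
  then have "flow (f - set p) (int k) t"
    using Suc.prems(2) pp unfolding flow_def by (simp add: algebra_simps)
  then obtain P where P: "finite P" "card P = k" "\<forall>q\<in>P. dpath (f - set p) q t"
      "pairwise (\<lambda>p q. set p \<inter> set q = {}) P"
    using Suc.IH[of "f - set p"] Suc.prems by auto
  have dj: "set q \<inter> set p = {}" if "q \<in> P" for q
    using dpath_props[of "f - set p" q t] P(3) that by auto
  have "p \<noteq> []" using p Suc.prems(3) by (auto elim: dpath.cases)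
  then have "p \<notin> P" using dj[of p] by auto
  then have "card (insert p P) = Suc k" using P by simp
  moreover have "\<forall>q\<in>insert p P. dpath f q t"
    using p P(3) dpath_mono[of "f - set p" _ t f] by auto
  moreover have "pairwise (\<lambda>p q. set p \<inter> set q = {}) (insert p P)"
    using P(4) dj by (auto simp: pairwise_insert)
  ultimately show ?case using P(1) by blast
qed

theorem menger:
  assumes "finite E" "t \<noteq> r"
  obtains P where "finite P" "card P = mincut E t" "\<And>p. p \<in> P \<Longrightarrow> dpath E p t"
    "pairwise (\<lambda>p q. set p \<inter> set q = {}) P"
proof -
  obtain f where f: "f \<subseteq> E" "flow f (int (mincut E t)) t"
    using max_flow_min_cut[OF assms, of "mincut E t"] mincut_le[of _ t E] by blast
  have "finite f" using f(1) assms(1) finite_subset by blast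
  then show thesis
    using flow_decompose[OF _ f(2) assms(2)] dpath_mono[OF _ f(1)] that by blast
qed

end

section \<open>Trails and paths in bidirected graphs\<close>

definition endpoint :: "'v \<Rightarrow> ('v, 'e) oedge list \<Rightarrow> 'v" where
  "endpoint v p = last (trail_verts v p)"

lemma trail_verts_simps [simp]:
  "trail_verts v [] = [v]" "trail_verts v (p @ [x]) = trail_verts v p @ [head x]"
  "trail_verts v p \<noteq> []" "length (trail_verts v p) = Suc (length p)"
  by (simp_all add: trail_verts_def)

lemma endpoint_simps [simp]:
  "endpoint v [] = v" "endpoint v (p @ [x]) = head x" "endpoint v (p @ x # q) = endpoint v (x # q)"
  "endpoint v [x] = head x"
  by (simp_all add: endpoint_def trail_verts_def)

lemma endpoint_nonempty: "p \<noteq> [] \<Longrightarrow> endpoint v p = head (last p)"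
  by (simp add: endpoint_def trail_verts_def last_map)

lemma endpoint_in: "endpoint v p \<in> set (trail_verts v p)"
  by (simp add: endpoint_def)

lemma set_trail_verts: "set (trail_verts v p) = insert v (head ` set p)"
  by (simp add: trail_verts_def)

lemma all_less_Suc_iff: "(\<forall>i<Suc n. P i) \<longleftrightarrow> P n \<and> (\<forall>i<n. P i)"
  by (auto simp: less_Suc_eq)

lemma trail_Nil [simp]: "trail B v [] \<longleftrightarrow> v \<in> verts B"
  by (simp add: trail_def)

lemma trail_snoc:
  "trail B v (p @ [x]) \<longleftrightarrow> trail B v p \<and> x \<in> oriented_edges B \<and> edge x \<notin> edge ` set p \<and>
    tail x = endpoint v p \<and>
    (p \<noteq> [] \<longrightarrow> sig B (edge x) (tail x) = opposite (sig B (edge (last p)) (tail x)))"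
proof -
  let ?T = "trail_verts v p"
  let ?S = "\<lambda>q i. sig B (edge (q ! Suc i)) (head (q ! i)) =
    opposite (sig B (edge (q ! i)) (head (q ! i)))"
  have last: "endpoint v p = ?T ! length p"
    by (simp add: endpoint_def last_conv_nth)
  have tails: "(\<forall>i<length (p @ [x]). tail ((p @ [x]) ! i) = trail_verts v (p @ [x]) ! i) \<longleftrightarrow>
      tail x = endpoint v p \<and> (\<forall>i<length p. tail (p ! i) = ?T ! i)"
    by (auto simp: all_less_Suc_iff nth_append last less_Suc_eq)
  have signs: "(\<forall>i. Suc i < length (p @ [x]) \<longrightarrow> ?S (p @ [x]) i) \<longleftrightarrow>
      (\<forall>i. Suc i < length p \<longrightarrow> ?S p i) \<and>
      (p \<noteq> [] \<longrightarrow> sig B (edge x) (endpoint v p) = opposite (sig B (edge (last p)) (endpoint v p)))"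
    (is "?L \<longleftrightarrow> ?R")
  proof (cases p rule: rev_cases)
    case (snoc p' y)
    have "?L \<longleftrightarrow> (\<forall>i<Suc (length p'). ?S (p @ [x]) i)"
      using snoc by simp
    also have "\<dots> \<longleftrightarrow> ?S (p @ [x]) (length p') \<and> (\<forall>i<length p'. ?S (p @ [x]) i)"
      by (rule all_less_Suc_iff)
    also have "\<dots> \<longleftrightarrow> ?R"
      unfolding snoc by (auto simp: nth_append)
    finally show ?thesis .
  qed simp
  show ?thesis
    unfolding trail_def tails signs by auto
qed

lemma trail_tail_in: "trail B v p \<Longrightarrow> x \<in> set p \<Longrightarrow> tail x \<in> set (trail_verts v p)"
  by (induction p rule: rev_induct) (auto simp: trail_snoc endpoint_in)

lemma oriented_edge_ends: "x \<in> oriented_edges B \<Longrightarrow> edge x \<in> edges B \<and> ends B (edge x) = {tail x, head x}"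
  by (auto simp: oriented_edges_def)

lemma path_Nil [simp]: "path B v [] \<longleftrightarrow> v \<in> verts B"
  by (simp add: path_def)

text \<open>Fresh vertices force fresh edges: an earlier occurrence of the edge would already have
  put \<open>head x\<close> on the path.\<close>

lemma path_snoc:
  "path B v (p @ [x]) \<longleftrightarrow> path B v p \<and> x \<in> oriented_edges B \<and> tail x = endpoint v p \<and>
    head x \<notin> set (trail_verts v p) \<and>
    (p \<noteq> [] \<longrightarrow> sig B (edge x) (tail x) = opposite (sig B (edge (last p)) (tail x)))"
proof -
  have "edge x \<notin> edge ` set p"
    if t: "trail B v p" and x: "x \<in> oriented_edges B" "head x \<notin> set (trail_verts v p)"
  proof
    assume "edge x \<in> edge ` set p"
    then obtain y where y: "y \<in> set p" "edge y = edge x" by auto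
    then have "y \<in> oriented_edges B" using t unfolding trail_def by auto
    then have "head x = tail y \<or> head x = head y"
      using oriented_edge_ends x(1) y(2) by (metis insertCI insertE singletonD)
    moreover have "head y \<in> set (trail_verts v p)" using y(1) by (simp add: set_trail_verts)
    ultimately show False using x(2) trail_tail_in[OF t y(1)] by metis
  qed
  then show ?thesis unfolding path_def trail_snoc by auto
qed

lemma path_prefix: "path B v (p @ q) \<Longrightarrow> path B v p"
  by (induction q rule: rev_induct) (auto simp: path_snoc simp flip: append_assoc)

text \<open>Both prefixes arrive through the same oriented edge \<open>b\<close>, so the sign
  condition after \<open>b\<close> carries over and only repeated vertices have to be
  excluded.\<close>

lemma path_splice:
  assumes "path B v (a @ b # c)" "path B v (p @ [b])"
    and "head ` set c \<inter> set (trail_verts v (p @ [b])) = {}"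
  shows "path B v (p @ b # c)"
  using assms
proof (induction c rule: rev_induct)
  case Nil
  then show ?case by simp
next
  case (snoc x c)
  have "path B v ((a @ b # c) @ [x])" using snoc.prems(1) by simp
  note x = this[unfolded path_snoc]
  then have dist: "head x \<notin> head ` set (b # c)" by (auto simp: set_trail_verts)
  have "path B v (p @ b # c)" using snoc x by auto
  then have "path B v ((p @ b # c) @ [x])"
    unfolding path_snoc using x dist snoc.prems(3) by (auto simp: set_trail_verts)
  then show ?case by simp
qed

lemma oriented_edges_restrict:
  "E \<subseteq> edges B \<Longrightarrow> oriented_edges (B\<lparr>edges := E\<rparr>) = {x \<in> oriented_edges B. edge x \<in> E}"
  by (auto simp: oriented_edges_def)

lemma path_restrict:
  "E \<subseteq> edges B \<Longrightarrow> path (B\<lparr>edges := E\<rparr>) v p \<longleftrightarrow> path B v p \<and> edge ` set p \<subseteq> E"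
  by (auto simp: path_def trail_def oriented_edges_restrict)

lemma path_to_restrict:
  "E \<subseteq> edges B \<Longrightarrow> path_to (B\<lparr>edges := E\<rparr>) v w \<alpha> p \<longleftrightarrow> path_to B v w \<alpha> p \<and> edge ` set p \<subseteq> E"
  by (auto simp: path_to_def path_restrict)

lemma path_edges: "path B v p \<Longrightarrow> set p \<subseteq> oriented_edges B"
  by (auto simp: path_def trail_def)

lemma opposite_simps [simp]: "opposite (opposite a) = a" "opposite a \<noteq> a" "a \<noteq> opposite a"
  by (cases a; simp)+

lemma opposite_eq_iff: "a = opposite b \<longleftrightarrow> a \<noteq> b"
  by (cases a; cases b; simp)

fun flip :: "('v, 'e) oedge \<Rightarrow> ('v, 'e) oedge" where
  "flip (u, e, w) = (w, e, u)"

lemma flip_simps [simp]: "flip (flip x) = x" "tail (flip x) = head x" "head (flip x) = tail x"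
  "edge (flip x) = edge x"
  by (cases x; simp)+

lemma flip_oriented [simp]: "flip x \<in> oriented_edges B \<longleftrightarrow> x \<in> oriented_edges B"
  by (cases x) (auto simp: oriented_edges_def)

lemma oriented_edges_same_edge:
  assumes "x \<in> oriented_edges B" "y \<in> oriented_edges B" "edge x = edge y"
  shows "x = y \<or> x = flip y"
  using assms by (cases x; cases y) (auto simp: oriented_edges_def doubleton_eq_iff)

section \<open>Trails from \<open>r\<close> as regular paths on oriented edges\<close>

definition follows :: "('v, 'e) bidir_graph \<Rightarrow> ('v, 'e) oedge \<Rightarrow> ('v, 'e) oedge \<Rightarrow> bool" where
  "follows B x y \<longleftrightarrow> x \<in> oriented_edges B \<and> y \<in> oriented_edges B \<and> head x = tail y \<and>
    sig B (edge y) (head x) = opposite (sig B (edge x) (head x))"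

lemma follows_flip: "follows B x y \<Longrightarrow> follows B (flip y) (flip x)"
  by (auto simp: follows_def)

fun trail_mate :: "('v, 'e) oedge + bool \<Rightarrow> ('v, 'e) oedge + bool" where
  "trail_mate (Inl x) = Inl (flip x)"
| "trail_mate (Inr b) = Inr (\<not> b)"

text \<open>\<open>Inr True\<close> is a virtual source that precedes all edges leaving \<open>r\<close>, and \<open>Inr False\<close> is its mate.\<close>

fun trail_step :: "('v, 'e) bidir_graph \<Rightarrow> 'v \<Rightarrow> unit \<Rightarrow>
    ('v, 'e) oedge + bool \<Rightarrow> ('v, 'e) oedge + bool \<Rightarrow> bool" where
  "trail_step B r _ (Inl x) (Inl y) \<longleftrightarrow> follows B x y \<and> head x \<noteq> r"
| "trail_step B r _ (Inr b) (Inl y) \<longleftrightarrow> b \<and> y \<in> oriented_edges B \<and> tail y = r"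
| "trail_step B r _ (Inl x) (Inr b) \<longleftrightarrow> \<not> b \<and> x \<in> oriented_edges B \<and> head x = r"
| "trail_step B r _ (Inr _) (Inr _) \<longleftrightarrow> False"

locale finite_rooted =
  fixes B :: "('v, 'e) bidir_graph" and r :: 'v
  assumes bidirected: "bidirected_graph B" and finite: "finite_graph B" and root: "r \<in> verts B"
begin

lemma loopless: "x \<in> oriented_edges B \<Longrightarrow> tail x \<noteq> head x"
  using bidirected by (cases x) (auto simp: oriented_edges_def bidirected_graph_def)

lemma oriented_edges_verts: "x \<in> oriented_edges B \<Longrightarrow> tail x \<in> verts B \<and> head x \<in> verts B"
  using bidirected by (cases x) (auto simp: oriented_edges_def bidirected_graph_def)

lemma finite_oriented_edges: "finite (oriented_edges B)"
proof (rule finite_subset)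
  show "oriented_edges B \<subseteq> verts B \<times> edges B \<times> verts B"
    using oriented_edges_verts by (fastforce simp: oriented_edges_def)
  show "finite (verts B \<times> edges B \<times> verts B)"
    using finite by (simp add: finite_graph_def)
qed

sublocale trails: skew_symmetric "Inl ` oriented_edges B \<union> range Inr" trail_mate "trail_step B r" "Inr True"
proof
  show "trail_mate (trail_mate x) = x" for x :: "('v, 'e) oedge + bool"
    by (cases x) auto
  show "trail_mate x \<noteq> x" if "x \<in> Inl ` oriented_edges B \<union> range Inr" for x
    using that loopless flip_simps(2) by fastforce
  show "trail_step B r e (trail_mate y) (trail_mate x)" if "trail_step B r e x y" for e x y
    using that by (cases x; cases y) (auto simp: follows_flip, auto simp: follows_def)
  show "y \<noteq> trail_mate x" if "trail_step B r e x y" for e x y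
    using that by (cases x; cases y) (auto simp: follows_def)
  show "trail_mate x \<in> Inl ` oriented_edges B \<union> range Inr"
    if "x \<in> Inl ` oriented_edges B \<union> range Inr" for x
    using that flip_oriented by fastforce
qed (use finite_oriented_edges in \<open>auto simp: follows_def elim!: trail_step.elims\<close>)

text \<open>Mates are the two orientations of one edge, so regularity amounts to using no edge
  twice. \<open>Inr False\<close> is never entered, being the mate of the source.\<close>

lemma reach_r_trail:
  "trails.reach A (Inr True) Y st \<Longrightarrow> st = Inr True \<and> Y = {Inr True} \<or>
    (\<exists>x p. st = Inl x \<and> r_trail_to B r x p \<and> Y = insert (Inr True) (Inl ` set p))"
proof (induction rule: trails.reach.induct)
  case (step Y x e y)
  have "Inr True \<in> Y" using trails.reach_endpoints step.hyps(1) by blast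
  then have "y \<noteq> Inr b" for b
    using step.hyps(4,5) by (cases b) auto
  then obtain y' where y: "y = Inl y'" by (cases y) auto
  from step.IH show ?case
  proof (elim disjE exE conjE)
    assume "x = Inr True" "Y = {Inr True}"
    moreover have "trail B r [y']"
      using step.hyps(3) y root trail_snoc[of B r "[]" y'] calculation by simp
    ultimately show ?thesis
      using y by (auto simp: r_trail_to_def r_trail_def intro!: exI[of _ "[y']"])
  next
    fix x' p assume p: "x = Inl x'" "r_trail_to B r x' p" "Y = insert (Inr True) (Inl ` set p)"
    have p': "p \<noteq> []" "last p = x'" "trail B r p" "r \<notin> set (map head (butlast p))"
      using p(2) unfolding r_trail_to_def r_trail_def by auto
    have f: "follows B x' y'" "head x' \<noteq> r" using step.hyps(3) p(1) y by simp_all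
    have "edge y' \<notin> edge ` set p"
    proof
      assume "edge y' \<in> edge ` set p"
      then obtain z where z: "z \<in> set p" "edge z = edge y'" by auto
      then have "z = y' \<or> z = flip y'"
        using oriented_edges_same_edge[of z B y'] p'(3) f(1) unfolding trail_def follows_def by blast
      then show False using step.hyps(4,5) z(1) p(3) y by auto
    qed
    then have "trail B r (p @ [y'])"
      unfolding trail_snoc using p' f(1) by (auto simp: follows_def endpoint_nonempty)
    moreover have "r \<notin> set (map head p)"
      using p'(1,2,4) f(2) by (cases p rule: rev_cases) auto
    ultimately have "r_trail_to B r y' (p @ [y'])"
      unfolding r_trail_to_def r_trail_def by simp
    then show ?thesis using y p(3) by (intro disjI2 exI[of _ y'] exI[of _ "p @ [y']"]) auto
  qed
qed simp

lemma path_reach: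
  "path B r p \<Longrightarrow> p \<noteq> [] \<Longrightarrow> trails.reach UNIV (Inr True) (insert (Inr True) (Inl ` set p)) (Inl (last p))"
proof (induction p rule: rev_induct)
  case (snoc x p)
  note x = snoc.prems(1)[unfolded path_snoc]
  have ed: "edge x \<notin> edge ` set p"
    using snoc.prems(1) unfolding path_def trail_snoc by blast
  then have new: "x \<notin> set p" "flip x \<notin> set p" by (force, metis flip_simps(4) imageI)
  show ?case
  proof (cases "p = []")
    case True
    have "trails.reach UNIV (Inr True) (insert (Inl x) {Inr True}) (Inl x)"
      by (rule trails.reach.step[OF trails.reach.refl, of "()"]) (use x True in auto)
    then show ?thesis using True by (simp add: insert_commute)
  next
    case False
    then have "head (last p) \<noteq> r"
      using x unfolding path_def trail_verts_def by (metis distinct.simps(2) imageI last_in_set list.set_map)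
    then have "trails.reach UNIV (Inr True) (insert (Inl x) (insert (Inr True) (Inl ` set p))) (Inl x)"
      using x False new path_edges[of B r p]
      by (intro trails.reach.step[OF snoc.IH, of "()"]) (auto simp: follows_def endpoint_nonempty)
    then show ?thesis by (simp add: insert_commute)
  qed
qed simp

text \<open>Edge-cleanness makes the blossom of the virtual source trivial, so all bases are genuine
  oriented edges.\<close>

lemma trail_blossoms:
  assumes clean: "edge_clean B r"
  obtains T bas where "T \<subseteq> oriented_edges B"
    "\<And>p. path B r p \<Longrightarrow> set p \<subseteq> T \<and> bas ` set p \<subseteq> set p"
    "\<And>x. x \<in> T \<Longrightarrow> bas x \<in> T" "\<And>x. x \<in> T \<Longrightarrow> flip (bas x) \<notin> T"
    "\<And>x. x \<in> T \<Longrightarrow> flip x \<notin> T \<Longrightarrow> bas x = x"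
    "\<And>x. x \<in> T \<Longrightarrow> flip x \<in> T \<Longrightarrow> bas (flip x) = bas x"
    "\<And>x. x \<in> T \<Longrightarrow> head x \<noteq> r"
    "\<And>x. x \<in> T \<Longrightarrow> tail x \<noteq> r \<Longrightarrow> \<exists>z\<in>T. follows B z x \<and> bas z \<noteq> x"
    "\<And>x y. x \<in> T \<Longrightarrow> y \<in> T \<Longrightarrow> follows B x (flip y) \<Longrightarrow> bas x = bas y"
proof -
  obtain R bs M where R: "R = {x. \<exists>Y. trails.reach UNIV (Inr True) Y x}"
    and "R = {x. \<exists>Y. trails.reach M (Inr True) Y x}" "finite M" "card M < card R"
    and R': "R \<subseteq> Inl ` oriented_edges B \<union> range Inr" "trail_mate (Inr True) \<notin> R"
    and bs: "\<And>x. x \<in> R \<Longrightarrow> bs x \<in> R" "\<And>x. x \<in> R \<Longrightarrow> trail_mate (bs x) \<notin> R"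
    "\<And>x. x \<in> R \<Longrightarrow> trail_mate x \<notin> R \<Longrightarrow> bs x = x"
    "\<And>x. x \<in> R \<Longrightarrow> trail_mate x \<in> R \<Longrightarrow> bs (trail_mate x) = bs x"
    and conn: "\<And>x. x \<in> R \<Longrightarrow> \<exists>Y. trails.reach UNIV (bs x) Y x \<and> Y \<subseteq> {y\<in>R. bs y = bs x}"
    and "\<And>p e y. p \<in> R \<Longrightarrow> trail_step B r e p y \<Longrightarrow> y \<in> R \<or> trail_mate y \<in> R"
    and closed: "\<And>p q e. p \<in> R \<Longrightarrow> q \<in> R \<Longrightarrow> trail_step B r e p (trail_mate q) \<Longrightarrow> bs p = bs q"
    and bs_path: "\<And>Y x. trails.reach UNIV (Inr True) Y x \<Longrightarrow> bs ` Y \<subseteq> Y"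
    by (rule trails.blossom_structure) (assumption | rule that)+
  define T where "T = {x. Inl x \<in> R}"
  define bas where "bas x = projl (bs (Inl x))" for x
  have no_undir: False if x: "x \<in> T" "flip x \<in> T" "head x = r" for x
  proof -
    have to: "\<exists>p. r_trail_to B r y p" if "y \<in> T" for y
      using that reach_r_trail unfolding T_def R by blast
    obtain u e w where xe: "x = (u, e, w)" by (cases x)
    have "x \<in> oriented_edges B" using x(1) R'(1) unfolding T_def by auto
    then have "trail_undirectable B r e" "e \<in> edges B" "r \<in> ends B e"
      using to[OF x(1)] to[OF x(2)] x(3) unfolding trail_undirectable_def xe
      by (auto simp: oriented_edges_def)
    then show False using clean unfolding edge_clean_def by blast
  qed
  have T_iff: "Inl x \<in> R \<longleftrightarrow> x \<in> T" for x by (simp add: T_def)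
  have TO: "T \<subseteq> oriented_edges B" using R'(1) unfolding T_def by auto
  have start: "x \<in> T" if "x \<in> oriented_edges B" "tail x = r" for x
    using trails.reach.step[OF trails.reach.refl, of "()" UNIV "Inr True" "Inl x"] that
    unfolding T_def R by auto
  \<comment> \<open>The reverse of an edge into \<open>r\<close> leaves \<open>r\<close> and so lies
    in \<open>T\<close>; the edge would be undirectable at \<open>r\<close>.\<close>
  have head_r: "head x \<noteq> r" if "x \<in> T" for x
    using that no_undir[of x] start[of "flip x"] TO by auto
  have base_Inl: "bs (Inl x) = Inl (bas x)" if x: "x \<in> T" for x
  proof (cases "bs (Inl x)")
    case (Inl y)
    then show ?thesis by (simp add: bas_def)
  next
    \<comment> \<open>Otherwise the blossom of the virtual source contains an edge leaving
      \<open>r\<close>. That edge is not its own base, so its reverse is also in \<open>T\<close>,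
      against edge-cleanness.\<close>
    case (Inr b)
    have xR: "Inl x \<in> R" using x by (simp add: T_def)
    have "Inr b \<in> R" using bs(1)[OF xR] Inr by simp
    then have s: "bs (Inl x) = Inr True" using R'(2) Inr by (cases b) simp_all
    obtain Y where Y: "trails.reach UNIV (Inr True) Y (Inl x)" "Y \<subseteq> {y\<in>R. bs y = Inr True}"
      using conn[OF xR] unfolding s by blast
    obtain y e where y: "y \<in> Y" "trail_step B r e (Inr True) y"
      using trails.reach_first_step[OF Y(1)] by blast
    obtain y' where y': "y = Inl y'" using y(2) by (cases y) simp_all
    have "tail y' = r" "Inl y' \<in> R" "bs (Inl y') = Inr True" using y y' Y(2) by auto
    moreover from this have "flip y' \<in> T" using bs(3)[of y] y' unfolding T_def by auto
    ultimately show ?thesis using no_undir[of "flip y'"] unfolding T_def by simp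
  qed
  show thesis
  proof (rule that[of T bas])
    show "T \<subseteq> oriented_edges B" by (fact TO)
    show "bas x \<in> T" "flip (bas x) \<notin> T" if "x \<in> T" for x
      using bs(1,2)[of "Inl x"] by (simp_all add: base_Inl[OF that] T_iff that)
    show "bas x = x" if "x \<in> T" "flip x \<notin> T" for x
      using bs(3)[of "Inl x"] by (simp add: base_Inl T_iff that)
    show "bas (flip x) = bas x" if "x \<in> T" "flip x \<in> T" for x
      using bs(4)[of "Inl x"] by (simp add: base_Inl T_iff that)
    show "head x \<noteq> r" if "x \<in> T" for x by (fact head_r[OF that])
    show "bas x = bas y" if "x \<in> T" "y \<in> T" "follows B x (flip y)" for x y
      using closed[of "Inl x" "Inl y" "()"] by (simp add: base_Inl T_iff that head_r)
    show "\<exists>z\<in>T. follows B z x \<and> bas z \<noteq> x" if x: "x \<in> T" "tail x \<noteq> r" for x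
    proof -
      obtain Y where "trails.reach UNIV (Inr True) Y (Inl x)" using x(1) unfolding T_def R by blast
      then obtain Y' z e where z: "trails.reach UNIV (Inr True) Y' z" "trail_step B r e z (Inl x)" "Inl x \<notin> Y'"
        by cases blast+
      obtain z' where z': "z = Inl z'" "follows B z' x" using z(2) x(2) by (cases z) simp_all
      have zT: "z' \<in> T" using z(1) z'(1) unfolding T_def R by blast
      have "bs z \<in> Y'" using bs_path[OF z(1)] trails.reach_endpoints[OF z(1)] by blast
      then have "bas z' \<noteq> x" using base_Inl[OF zT] z(3) z'(1) by metis
      then show ?thesis using zT z'(2) by blast
    qed
    show "set p \<subseteq> T \<and> bas ` set p \<subseteq> set p" if p: "path B r p" for p
    proof
      show sub: "set p \<subseteq> T"
      proof
        fix x assume "x \<in> set p"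
        then obtain p1 p2 where "p = p1 @ x # p2" by (meson split_list)
        then have "path B r (p1 @ [x])" using p path_prefix[of B r "p1 @ [x]" p2] by simp
        then show "x \<in> T" using path_reach[of "p1 @ [x]"] unfolding T_def R by auto
      qed
      show "bas ` set p \<subseteq> set p"
      proof (cases "p = []")
        case False
        then have *: "bs ` insert (Inr True) (Inl ` set p) \<subseteq> insert (Inr True) (Inl ` set p)"
          by (rule bs_path[OF path_reach[OF p]])
        show ?thesis
        proof (rule image_subsetI)
          fix x assume "x \<in> set p"
          then have "bs (Inl x) \<in> insert (Inr True) (Inl ` set p)" "x \<in> T" using * sub by blast+
          then show "bas x \<in> set p" using base_Inl[of x] by auto
        qed
      qed simp
    qed
  qed
qed

section \<open>Paths from \<open>r\<close> as regular paths on signed vertices\<close>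

fun path_mate :: "'v \<times> sign \<Rightarrow> 'v \<times> sign" where
  "path_mate (v, \<alpha>) = (v, opposite \<alpha>)"

text \<open>A state carries the sign with which its vertex is entered, and the next edge leaves with
  the opposite sign. At \<open>r\<close> the real signs are overridden: every edge may leave in
  state \<open>Plus\<close>, and entering gives \<open>Minus\<close>, the mate of the source. Hence
  any edge at \<open>r\<close> can start a path, and none can return.\<close>

fun path_step :: "'e \<Rightarrow> 'v \<times> sign \<Rightarrow> 'v \<times> sign \<Rightarrow> bool" where
  "path_step e (v, \<alpha>) (u, \<beta>) \<longleftrightarrow> (v, e, u) \<in> oriented_edges B \<and>
    (if v = r then \<alpha> = Plus else sig B e v = opposite \<alpha>) \<and>
    (if u = r then \<beta> = Minus else sig B e u = \<beta>)"

sublocale paths: skew_symmetric "verts B \<times> UNIV" path_mate path_step "(r, Plus)"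
proof
  have "(UNIV :: sign set) = {Plus, Minus}" using sign.exhaust by auto
  then have "finite (UNIV :: sign set)" by (metis finite.emptyI finite_insert)
  then show "finite (verts B \<times> (UNIV :: sign set))"
    using finite by (simp add: finite_graph_def)
  show "path_step e (path_mate y) (path_mate x)" if "path_step e x y" for e x y
    using that flip_oriented[of "(fst x, e, fst y)" B]
    by (cases x; cases y) (auto simp: opposite_eq_iff split: if_splits)
  show "y \<noteq> path_mate x" if "path_step e x y" for e x y
    using that loopless by (cases x; cases y) fastforce
  show "y \<in> verts B \<times> UNIV" if "path_step e x y" for e x y
    using that oriented_edges_verts by (cases x; cases y) fastforce
qed (use root in auto)

text \<open>Mates have the same vertex, so here regularity means that no vertex is repeated.\<close>

lemma reach_path:
  "paths.reach A (r, Plus) Y st \<Longrightarrow> \<exists>p. path B r p \<and> edge ` set p \<subseteq> A \<and>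
    fst ` Y = set (trail_verts r p) \<and> endpoint r p = fst st \<and>
    (p \<noteq> [] \<longrightarrow> sig B (edge (last p)) (fst st) = snd st)"
proof (induction rule: paths.reach.induct)
  case refl
  show ?case using root by (intro exI[of _ "[]"]) simp
next
  case (step Y x e y)
  obtain v \<alpha> u \<beta> where xy: "x = (v, \<alpha>)" "y = (u, \<beta>)" by (cases x; cases y)
  obtain p where p: "path B r p" "edge ` set p \<subseteq> A" "fst ` Y = set (trail_verts r p)"
      "endpoint r p = v" "p \<noteq> [] \<longrightarrow> sig B (edge (last p)) v = \<alpha>"
    using step.IH xy by auto
  have "u \<notin> fst ` Y"
  proof
    assume "u \<in> fst ` Y"
    then obtain \<gamma> where "(u, \<gamma>) \<in> Y" by auto
    then show False using step.hyps(4,5) xy by (cases "\<gamma> = \<beta>") (auto simp flip: opposite_eq_iff)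
  qed
  moreover from this have "u \<noteq> r" using p(3) by (auto simp: set_trail_verts)
  moreover have "v \<noteq> r" if "p \<noteq> []"
    using that p(1,4) endpoint_nonempty[OF that, of r] unfolding path_def trail_verts_def
    by (metis distinct.simps(2) imageI last_in_set list.set_map)
  ultimately have "path B r (p @ [(v, e, u)])"
    unfolding path_snoc using p step.hyps(3) xy by auto
  then show ?case using p step.hyps(2,3) xy \<open>u \<noteq> r\<close>
    by (intro exI[of _ "p @ [(v, e, u)]"]) auto
qed

lemma path_reach_sign:
  "path B r p \<Longrightarrow> edge ` set p \<subseteq> A \<Longrightarrow> \<exists>Y. fst ` Y = set (trail_verts r p) \<and>
    paths.reach A (r, Plus) Y
      (endpoint r p, if p = [] then Plus else sig B (edge (last p)) (endpoint r p))"
proof (induction p rule: rev_induct)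
  case Nil
  show ?case using paths.reach.refl[of A "(r, Plus)"] by (intro exI[of _ "{(r, Plus)}"]) simp
next
  case (snoc x p)
  note x = snoc.prems(1)[unfolded path_snoc]
  let ?\<alpha> = "if p = [] then Plus else sig B (edge (last p)) (endpoint r p)"
  obtain Y where Y: "fst ` Y = set (trail_verts r p)" "paths.reach A (r, Plus) Y (endpoint r p, ?\<alpha>)"
    using snoc.IH x snoc.prems(2) by auto
  let ?y = "(head x, sig B (edge x) (head x))"
  have new: "head x \<notin> fst ` Y" "head x \<noteq> r" using x Y(1) by (auto simp: set_trail_verts)
  have "endpoint r p \<noteq> r" if "p \<noteq> []"
    using that x endpoint_nonempty[OF that, of r] unfolding path_def trail_verts_def
    by (metis distinct.simps(2) imageI last_in_set list.set_map)
  then have "path_step (edge x) (endpoint r p, ?\<alpha>) ?y"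
    using x new by (cases x) (auto split: if_splits)
  then have "paths.reach A (r, Plus) (insert ?y Y) ?y"
    using new(1) snoc.prems(2) by (intro paths.reach.step[OF Y(2), of "edge x"]) (auto, force+)
  then show ?case using Y(1) by (intro exI[of _ "insert ?y Y"]) auto
qed

text \<open>A tree of paths need not suffice for \<open>M\<close>: of two paths with the same end, one may extend along
  an edge where the other repeats a vertex.\<close>

lemma few_edges_reach_all:
  obtains M where "finite M" "finite {(v, \<alpha>). \<exists>p. path_to B r v \<alpha> p}"
    "card M \<le> card {(v, \<alpha>). \<exists>p. path_to B r v \<alpha> p}"
    "\<And>v \<alpha> p. path_to B r v \<alpha> p \<Longrightarrow> \<exists>q. path_to B r v \<alpha> q \<and> edge ` set q \<subseteq> M"
proof -
  obtain R M where R: "R = {x. \<exists>Y. paths.reach UNIV (r, Plus) Y x}"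
    "R = {x. \<exists>Y. paths.reach M (r, Plus) Y x}" "finite M" "card M < card R"
    "R \<subseteq> verts B \<times> UNIV" "path_mate (r, Plus) \<notin> R"
    by (rule paths.few_labels_reach_all) (rule that)
  have src: "(r, Plus) \<in> R" unfolding R(1) using paths.reach.refl by blast
  have fin: "finite R" using R(4) card.infinite by fastforce
  have not_root: "v \<noteq> r" if "(v, \<alpha>) \<in> R - {(r, Plus)}" for v \<alpha>
    using that R(6) by (cases \<alpha>) auto
  have to: "\<exists>q. path_to B r v \<alpha> q \<and> edge ` set q \<subseteq> M" if "(v, \<alpha>) \<in> R - {(r, Plus)}" for v \<alpha>
  proof -
    have "\<exists>Y. paths.reach M (r, Plus) Y (v, \<alpha>)" using that R(2) by blast
    then obtain p where p: "path B r p" "edge ` set p \<subseteq> M" "endpoint r p = v"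
        "p \<noteq> [] \<longrightarrow> sig B (edge (last p)) v = \<alpha>"
      using reach_path by fastforce
    have "p \<noteq> []" using p(3) not_root[OF that] by auto
    then show ?thesis using p by (auto simp: path_to_def endpoint_nonempty)
  qed
  have from_path: "(v, \<alpha>) \<in> R - {(r, Plus)}" if "path_to B r v \<alpha> p" for v \<alpha> p
  proof -
    have p: "path B r p" "p \<noteq> []" "endpoint r p = v" "sig B (edge (last p)) v = \<alpha>"
      using that by (auto simp: path_to_def endpoint_nonempty)
    have "v \<noteq> r"
      using p endpoint_nonempty[OF p(2), of r] unfolding path_def trail_verts_def
      by (metis distinct.simps(2) imageI last_in_set list.set_map)
    moreover have "(v, \<alpha>) \<in> R"
      unfolding R(1) using path_reach_sign[OF p(1), of UNIV] p by auto
    ultimately show ?thesis by simp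
  qed
  have eq: "{(v, \<alpha>). \<exists>p. path_to B r v \<alpha> p} = R - {(r, Plus)}"
    using to from_path by fast
  show thesis
  proof (rule that[of M])
    show "card M \<le> card {(v, \<alpha>). \<exists>p. path_to B r v \<alpha> p}"
      unfolding eq using R(4) fin src by simp
  qed (use R(3) fin to from_path in \<open>auto simp: eq\<close>)
qed

end

section \<open>Contracting the blossoms\<close>

lemma path_conn_set:
  fixes G :: "('v, 'e) bidir_graph"
  assumes "finite (edges G)"
  shows "finite {card P | P. finite P \<and> (\<forall>p\<in>P. path_to G v w \<alpha> p) \<and> pairwise edge_disjoint P}" (is "finite ?N")
    and "{card P | P. finite P \<and> (\<forall>p\<in>P. path_to G v w \<alpha> p) \<and> pairwise edge_disjoint P} \<noteq> {}"
proof -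
  have "?N \<subseteq> {..card (edges G)}"
    using card_edge_disjoint_paths_le[OF assms] by fastforce
  then show "finite ?N" by (rule finite_subset) simp
  have "card ({} :: ('v, 'e) oedge list set) \<in> ?N"
    by (intro CollectI exI[of _ "{}"]) simp
  then show "?N \<noteq> {}" by blast
qed

lemma path_conn_attained:
  assumes "finite (edges G)"
  obtains P where "finite P" "\<And>p. p \<in> P \<Longrightarrow> path_to G v w \<alpha> p" "pairwise edge_disjoint P"
    "card P = path_conn G \<alpha> v w"
proof -
  have "path_conn G \<alpha> v w \<in>
      {card P | P. finite P \<and> (\<forall>p\<in>P. path_to G v w \<alpha> p) \<and> pairwise edge_disjoint P}"
    unfolding path_conn_def by (rule Max_in[OF path_conn_set[OF assms]])
  then show thesis using that by (elim CollectE exE conjE) simp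
qed

lemma path_conn_ge:
  assumes "finite (edges G)" "finite P" "\<And>p. p \<in> P \<Longrightarrow> path_to G v w \<alpha> p" "pairwise edge_disjoint P"
  shows "card P \<le> path_conn G \<alpha> v w"
  unfolding path_conn_def
proof (rule Max_ge)
  show "card P \<in> {card P | P. finite P \<and> (\<forall>p\<in>P. path_to G v w \<alpha> p) \<and> pairwise edge_disjoint P}"
    using assms(2-) by (intro CollectI exI[of _ P]) simp
qed (rule path_conn_set[OF assms(1)])

lemma path_to_endpoint: "path_to G v w \<alpha> p \<Longrightarrow> path G v p \<and> p \<noteq> [] \<and> endpoint v p = w \<and>
    sig G (edge (last p)) w = \<alpha> \<and> w \<noteq> v"
proof -
  assume *: "path_to G v w \<alpha> p"
  then have p: "path G v p" "p \<noteq> []" "head (last p) = w" "sig G (edge (last p)) w = \<alpha>"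
    by (simp_all add: path_to_def)
  then have "w \<in> head ` set p" by (metis imageI last_in_set)
  moreover have "v \<notin> head ` set p" using p(1) by (simp add: path_def trail_verts_def)
  ultimately show ?thesis using p endpoint_nonempty[OF p(2), of v] by auto
qed

lemma path_follows: "path B v (p @ [x]) \<Longrightarrow> p \<noteq> [] \<Longrightarrow> follows B (last p) x"
proof -
  assume "path B v (p @ [x])" and p: "p \<noteq> []"
  note x = this(1)[unfolded path_snoc]
  then have "last p \<in> oriented_edges B" using path_edges[of B v p] last_in_set[OF p] by blast
  moreover have t: "tail x = head (last p)" using x endpoint_nonempty[OF p] by simp
  moreover have "sig B (edge x) (tail x) = opposite (sig B (edge (last p)) (tail x))"
    using x p by blast
  ultimately show ?thesis using x unfolding follows_def t by simp
qed

text \<open>The assumptions are the conclusions of \<open>trail_blossoms\<close>: \<open>T\<close> consists of the last edges of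
  \<open>r\<close>-trails, and \<open>bas\<close> maps an edge of a blossom to the only edge entering this blossom.\<close>

locale trail_structure = finite_rooted B r for B :: "('v, 'e) bidir_graph" and r :: 'v +
  fixes T :: "('v, 'e) oedge set" and bas :: "('v, 'e) oedge \<Rightarrow> ('v, 'e) oedge"
  assumes T_oriented: "T \<subseteq> oriented_edges B"
    and path_T: "path B r p \<Longrightarrow> set p \<subseteq> T" and path_bas: "path B r p \<Longrightarrow> bas ` set p \<subseteq> set p"
    and bas_T: "x \<in> T \<Longrightarrow> bas x \<in> T" and flip_bas: "x \<in> T \<Longrightarrow> flip (bas x) \<notin> T"
    and bas_directed: "x \<in> T \<Longrightarrow> flip x \<notin> T \<Longrightarrow> bas x = x"
    and bas_flip: "x \<in> T \<Longrightarrow> flip x \<in> T \<Longrightarrow> bas (flip x) = bas x"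
    and head_not_root: "x \<in> T \<Longrightarrow> head x \<noteq> r"
    and predecessor: "x \<in> T \<Longrightarrow> tail x \<noteq> r \<Longrightarrow> \<exists>z\<in>T. follows B z x \<and> bas z \<noteq> x"
    and bas_follows: "x \<in> T \<Longrightarrow> y \<in> T \<Longrightarrow> follows B x (flip y) \<Longrightarrow> bas x = bas y"
begin

section \<open>The contracted digraph\<close>

definition undirected :: "('v, 'e) oedge set" where
  "undirected = {x \<in> T. flip x \<in> T}"

text \<open>The vertices after contracting the blossoms; a blossom is represented by the edge that enters it.\<close>

definition node :: "'v \<Rightarrow> 'v + ('v, 'e) oedge" where
  "node v = (if \<exists>y\<in>undirected. head y = v then Inr (bas (SOME y. y \<in> undirected \<and> head y = v)) else Inl v)"

text \<open>If \<open>x\<close> and \<open>y\<close> have different signs at the common head,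
  \<open>x\<close> can be followed by \<open>flip y\<close>, and closedness equates their bases. If
  the signs agree, any predecessor of \<open>flip y\<close> can also be followed by
  \<open>flip x\<close>, so both bases equal the base of this predecessor.\<close>

lemma same_head_bas:
  assumes x: "x \<in> T" and y: "y \<in> undirected" and xy: "head x = head y"
  shows "bas x = bas y"
proof -
  have yT: "y \<in> T" "flip y \<in> T" using y by (simp_all add: undirected_def)
  have oe: "x \<in> oriented_edges B" "y \<in> oriented_edges B" using x yT T_oriented by blast+
  show ?thesis
  proof (cases "sig B (edge x) (head x) = sig B (edge y) (head x)")
    case False
    then have "follows B x (flip y)"
      using oe xy by (auto simp: follows_def opposite_eq_iff)
    then show ?thesis using bas_follows x yT by blast
  next
    case True
    obtain z where z: "z \<in> T" "follows B z (flip y)"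
      using predecessor[OF yT(2)] head_not_root[OF yT(1)] by auto
    have "follows B z (flip x)"
      using z(2) oe xy True by (auto simp: follows_def)
    then have "bas z = bas x" using bas_follows z(1) x by blast
    moreover have "bas z = bas y" using bas_follows z yT(1) by blast
    ultimately show ?thesis by simp
  qed
qed

lemma node_undirected:
  assumes "y \<in> undirected" shows "node (head y) = Inr (bas y)"
proof -
  let ?z = "SOME z. z \<in> undirected \<and> head z = head y"
  have z: "?z \<in> undirected \<and> head ?z = head y"
    by (rule someI[of _ y]) (use assms in simp)
  then have "bas ?z = bas y"
    using same_head_bas[of ?z y] assms by (auto simp: undirected_def)
  then show ?thesis using assms unfolding node_def by auto
qed

lemma node_Inr:
  assumes x: "x \<in> T" and node: "node (head x) = Inr b" shows "bas x = b"
proof -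
  obtain y where y: "y \<in> undirected" "head y = head x"
    using node unfolding node_def by (meson Inl_Inr_False)
  then show ?thesis using same_head_bas[OF x y(1)] node_undirected[OF y(1)] node by simp
qed

lemma node_Inl: "node v = Inl w \<Longrightarrow> w = v"
  unfolding node_def by (simp split: if_splits)

lemma node_root [simp]: "node r = Inl r"
proof -
  have "\<not> (\<exists>y\<in>undirected. head y = r)" using head_not_root by (auto simp: undirected_def)
  then show ?thesis by (simp add: node_def)
qed

lemma undirected_same_node:
  assumes "x \<in> undirected" shows "node (tail x) = node (head x)"
proof -
  have "flip x \<in> undirected" "bas (flip x) = bas x"
    using assms bas_flip by (simp_all add: undirected_def)
  then show ?thesis using node_undirected[OF assms] node_undirected[of "flip x"] by simp
qed

text \<open>With different signs \<open>x\<close> could be followed by \<open>flip y\<close>; then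
  the bases of \<open>x\<close> and \<open>y\<close> would agree, but directed edges are their own
  bases.\<close>

lemma directed_sign:
  assumes "x \<in> T" "flip x \<notin> T" "y \<in> T" "flip y \<notin> T" "head x = head y"
  shows "sig B (edge x) (head x) = sig B (edge y) (head x)"
proof (rule ccontr)
  assume "\<not> ?thesis"
  moreover from this have "follows B x (flip y)"
    using assms T_oriented by (auto simp: follows_def opposite_eq_iff)
  then have "x = y" using bas_follows[of x y] bas_directed assms by simp
  ultimately show False by simp
qed

text \<open>\<open>T\<close> only guarantees trails to its edges. Paths are required here because
  the lift of an arc whose tail lies in a blossom needs a path leading up to that arc.\<close>

definition D :: "('v, 'e) oedge set" where
  "D = {d \<in> T. flip d \<notin> T \<and> (\<exists>p. path B r p \<and> p \<noteq> [] \<and> last p = d)}"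

lemma finite_D: "finite D"
proof (rule finite_subset)
  show "D \<subseteq> oriented_edges B" using T_oriented by (auto simp: D_def)
qed (rule finite_oriented_edges)

sublocale dg: digraph "\<lambda>x. node (tail x)" "\<lambda>x. node (head x)" "Inl r" .

lemma D_node_Inr: "d \<in> D \<Longrightarrow> node (head d) = Inr b \<Longrightarrow> d = b"
  using node_Inr[of d b] bas_directed[of d] by (simp add: D_def)

section \<open>Lifting digraph paths through the blossoms\<close>

lemma bas_after_base:
  "path B r (a @ b # c) \<Longrightarrow> bas (last (b # c)) = b \<Longrightarrow> set c \<subseteq> {y \<in> undirected. bas y = b}"
proof (induction c rule: rev_induct)
  case (snoc x c)
  have path: "path B r ((a @ b # c) @ [x])" using snoc.prems(1) by simp
  have "distinct (map edge ((a @ b # c) @ [x]))" using path unfolding path_def trail_def by blast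
  then have "x \<noteq> b" by auto
  have bx: "bas x = b" using snoc.prems(2) by simp
  have T: "set ((a @ b # c) @ [x]) \<subseteq> T" using path_T[OF path] .
  then have x: "x \<in> T" "flip x \<in> T" using bas_directed[of x] bx \<open>x \<noteq> b\<close> by auto
  have "last (b # c) \<in> set (b # c)" by (rule last_in_set) simp
  then have "last (b # c) \<in> T" using T by auto
  \<comment> \<open>Written with a double \<open>flip\<close> so that closedness applies to
    \<open>flip x\<close>, which lies in \<open>T\<close>. Thus the preceding edge has the same
    base, and the blossom is traced back as far as \<open>b\<close>.\<close>
  moreover have "follows B (last (b # c)) (flip (flip x))"
    using path_follows[OF path] by simp
  ultimately have "bas (last (b # c)) = b"
    using bas_follows[of "last (b # c)" "flip x"] x bas_flip bx by simp
  then have "set c \<subseteq> {y \<in> undirected. bas y = b}"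
    using snoc.IH path_prefix[OF path] by blast
  then show ?case using x bx by (simp add: undirected_def)
qed simp

text \<open>By \<open>path_bas\<close> the path \<open>p\<close> traverses \<open>b\<close> and by
  \<open>bas_after_base\<close> it then stays in the blossom. Its remainder can be spliced onto any
  path that first meets the blossom through \<open>b\<close>. As \<open>c\<close> consists of edges
  of \<open>p\<close>, it inherits any restriction on the edges of \<open>p\<close>.\<close>

lemma enter_blossom:
  assumes q: "path B r q" "q \<noteq> []" "last q = b" and out: "\<forall>u\<in>set (butlast (trail_verts r q)). node u \<noteq> Inr b"
    and p: "path_to B r v \<beta> p" and v: "node v = Inr b"
  shows "\<exists>c. path_to B r v \<beta> (q @ c) \<and> set c \<subseteq> {y \<in> undirected. bas y = b} \<inter> set p"
proof -
  note p' = path_to_endpoint[OF p]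
  have "last p \<in> set p" using p' by simp
  moreover from this have "last p \<in> T" using path_T p' by blast
  then have bl: "bas (last p) = b"
    using node_Inr[of "last p" b] v p' endpoint_nonempty[of p r] by simp
  ultimately have "b \<in> set p" using path_bas[of p] p' by blast
  then obtain a c where ac: "p = a @ b # c" by (meson split_list)
  have c: "set c \<subseteq> {y \<in> undirected. bas y = b}"
    using bas_after_base[of a b c] p' bl ac by simp
  obtain q' where q': "q = q' @ [b]" using q(2,3) append_butlast_last_id by metis
  have "path B r (q' @ b # c)"
  proof (rule path_splice)
    show "path B r (a @ b # c)" "path B r (q' @ [b])" using p' ac q(1) q' by simp_all
    have "distinct (trail_verts r p)" using p' unfolding path_def by blast
    then have "head b \<notin> head ` set c" unfolding ac trail_verts_def by auto
    have "head y \<notin> set (trail_verts r (q' @ [b]))" if y: "y \<in> set c" for y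
    proof -
      have "head y \<noteq> head b" using y \<open>head b \<notin> head ` set c\<close> by (metis imageI)
      moreover have "node (head y) = Inr b" using c y node_undirected by blast
      then have "head y \<notin> set (trail_verts r q')" using out q' by auto
      ultimately show ?thesis by simp
    qed
    then show "head ` set c \<inter> set (trail_verts r (q' @ [b])) = {}" by blast
  qed
  then have "path B r (q @ c)" using q' by simp
  moreover have "last (q @ c) = last p" using q' ac by simp
  ultimately have "path_to B r v \<beta> (q @ c)" using p q(2) unfolding path_to_def by auto
  then show ?thesis using c ac by (intro exI[of _ c]) auto
qed

text \<open>That the node \<open>n\<close> is met only at the end is what allows
  \<open>enter_blossom\<close> to continue inside a blossom. Tying the undirected edges to bases on
  \<open>p\<close> keeps lifts of disjoint digraph paths disjoint.\<close>

lemma lift_dpath: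
  assumes M: "\<forall>v \<alpha> p. path_to B r v \<alpha> p \<longrightarrow> (\<exists>q. path_to B r v \<alpha> q \<and> edge ` set q \<subseteq> M)"
    and "E \<subseteq> D" "dg.dpath E p n"
  shows "\<exists>q. path B r q \<and> (p = [] \<longrightarrow> q = []) \<and> (p \<noteq> [] \<longrightarrow> q \<noteq> [] \<and> last q = last p) \<and>
    set q \<subseteq> set p \<union> {y \<in> undirected. bas y \<in> set p \<and> edge y \<in> M} \<and> node (endpoint r q) = n \<and>
    (\<forall>u\<in>set (butlast (trail_verts r q)). node u \<in> insert (Inl r) ((\<lambda>x. node (head x)) ` set p) - {n})"
  using assms(3)
proof (induction rule: dg.dpath.induct)
  case nil
  show ?case using root by (intro exI[of _ "[]"]) simp
next
  case (snoc p e)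
  let ?N = "insert (Inl r) ((\<lambda>x. node (head x)) ` set p)"
  obtain q where q: "path B r q" "p = [] \<longrightarrow> q = []" "p \<noteq> [] \<longrightarrow> q \<noteq> [] \<and> last q = last p"
    "set q \<subseteq> set p \<union> {y \<in> undirected. bas y \<in> set p \<and> edge y \<in> M}" "node (endpoint r q) = node (tail e)"
    "\<forall>u\<in>set (butlast (trail_verts r q)). node u \<in> ?N - {node (tail e)}"
    using snoc.IH by (elim exE conjE) (rule that)
  have pE: "set p \<subseteq> D" and nN: "node (tail e) \<in> ?N"
    using dg.dpath_props[OF snoc.hyps(1)] assms(2) by auto
  have qN: "node u \<in> ?N" if "u \<in> set (trail_verts r q)" for u
  proof -
    have "trail_verts r q = butlast (trail_verts r q) @ [endpoint r q]"
      unfolding endpoint_def by simp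
    then have "u \<in> set (butlast (trail_verts r q)) \<or> u = endpoint r q"
      using that by (metis Un_iff empty_iff empty_set set_ConsD set_append)
    then show ?thesis
    proof
      assume "u \<in> set (butlast (trail_verts r q))"
      then show ?thesis using bspec[OF q(6)] by simp
    next
      assume "u = endpoint r q"
      then show ?thesis using q(5) nN by simp
    qed
  qed
  have e: "e \<in> T" "flip e \<notin> T" "e \<in> oriented_edges B"
    using snoc.hyps(2) assms(2) T_oriented by (auto simp: D_def)
  obtain q0 where q0: "path B r (q0 @ [e])"
  proof -
    obtain p0 where "path B r p0" "p0 \<noteq> []" "last p0 = e"
      using snoc.hyps(2) assms(2) by (auto simp: D_def)
    then have "path B r (butlast p0 @ [e])" using append_butlast_last_id[of p0] by simp
    then show ?thesis by (rule that)
  qed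
  have "\<exists>q'. path B r q' \<and> endpoint r q' = tail e \<and>
      (q' \<noteq> [] \<longrightarrow> sig B (edge e) (tail e) = opposite (sig B (edge (last q')) (tail e))) \<and>
      set q' \<subseteq> set p \<union> {y \<in> undirected. bas y \<in> set p \<and> edge y \<in> M} \<and>
      (\<forall>u\<in>set (trail_verts r q'). node u \<in> ?N)"
  proof (cases "node (tail e)")
    case (Inl w)
    have end_q: "endpoint r q = tail e" 
      using node_Inl[of "endpoint r q" w] node_Inl[of "tail e" w] q(5) Inl by simp
    have "sig B (edge e) (tail e) = opposite (sig B (edge (last q)) (tail e))" if "q \<noteq> []"
    proof -
      let ?d = "last q"
      have d: "?d \<in> D" "head ?d = tail e"
      proof -
        have "p \<noteq> []" "?d = last p" using q(2,3) that by auto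
        then show "?d \<in> D" using pE last_in_set by auto
        show "head ?d = tail e" using end_q endpoint_nonempty[OF that, of r] by simp
      qed
      then have "tail e \<noteq> r" using head_not_root[of ?d] by (simp add: D_def)
      \<comment> \<open>\<open>tail e\<close> lies in no blossom, so a predecessor \<open>z\<close>
        of \<open>e\<close> is directed and agrees in sign with the arc by which \<open>q\<close>
        arrives.\<close>
      then obtain z where z: "z \<in> T" "follows B z e" using predecessor e(1) by blast
      then have hz: "head z = tail e" by (simp add: follows_def)
      then have "flip z \<notin> T" using node_undirected[of z] z(1) Inl by (auto simp: undirected_def)
      then have "sig B (edge z) (head z) = sig B (edge ?d) (head z)"
        using directed_sign[of z ?d] z(1) d hz by (auto simp: D_def)
      then show ?thesis using z(2) hz by (simp add: follows_def)
    qed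
    then show ?thesis using q(1,4) end_q qN by (intro exI[of _ q]) simp
  next
    case (Inr b)
    then have te: "tail e \<noteq> r" using node_root by (metis Inl_Inr_False)
    have "q \<noteq> []" using q(5) Inr by auto
    then have p: "p \<noteq> []" "last q = last p" using q(2,3) by auto
    have "last p \<in> D" "node (head (last p)) = Inr b"
      using p(1) pE dg.dpath_last[OF snoc.hyps(1) p(1)] Inr by auto
    then have "last p = b" by (rule D_node_Inr)
    then have b: "last q = b" "b \<in> set p" using p last_in_set[OF p(1)] by simp_all
    \<comment> \<open>The blossom must be traversed to \<open>tail e\<close> and reached there with
      the sign \<beta> that lets \<open>e\<close> follow. A path up to \<open>e\<close> in
      \<open>B\<close> shows that this pair is reachable, hence it is reachable within
      \<open>M\<close>.\<close>
    have x: "path B r q0" "tail e = endpoint r q0"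
        "q0 \<noteq> [] \<longrightarrow> sig B (edge e) (tail e) = opposite (sig B (edge (last q0)) (tail e))"
      using q0[unfolded path_snoc] by blast+
    then have "q0 \<noteq> []" using te by auto
    define \<beta> where "\<beta> = sig B (edge (last q0)) (tail e)"
    have "path_to B r (tail e) \<beta> q0"
      using x \<open>q0 \<noteq> []\<close> by (simp add: path_to_def \<beta>_def endpoint_nonempty)
    from M[rule_format, OF this] obtain q1 where q1: "path_to B r (tail e) \<beta> q1" "edge ` set q1 \<subseteq> M" by blast
    obtain c where c: "path_to B r (tail e) \<beta> (q @ c)" "set c \<subseteq> {y \<in> undirected. bas y = b} \<inter> set q1"
    proof -
      have "\<forall>u\<in>set (butlast (trail_verts r q)). node u \<noteq> Inr b" using q(6) Inr by simp
      from enter_blossom[OF q(1) \<open>q \<noteq> []\<close> b(1) this q1(1) Inr] that show ?thesis by blast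
    qed
    have "node u \<in> ?N" if u: "u \<in> set (trail_verts r (q @ c))" for u
    proof (cases "u \<in> head ` set c")
      case True
      then have "node u = Inr b" using c(2) node_undirected by blast
      then show ?thesis using nN Inr by simp
    next
      case False
      then show ?thesis using u qN by (auto simp: set_trail_verts)
    qed
    moreover have "set (q @ c) \<subseteq> set p \<union> {y \<in> undirected. bas y \<in> set p \<and> edge y \<in> M}"
    proof -
      have "set c \<subseteq> {y \<in> undirected. bas y \<in> set p \<and> edge y \<in> M}"
        using c(2) b(2) q1(2) by blast
      then show ?thesis using q(4) unfolding set_append by blast
    qed
    ultimately show ?thesis
      using path_to_endpoint[OF c(1)] x(3) \<open>q0 \<noteq> []\<close>
      by (intro exI[of _ "q @ c"]) (auto simp: \<beta>_def)
  qed
  then obtain q' where q': "path B r q'" "endpoint r q' = tail e"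
      "q' \<noteq> [] \<longrightarrow> sig B (edge e) (tail e) = opposite (sig B (edge (last q')) (tail e))"
      "set q' \<subseteq> set p \<union> {y \<in> undirected. bas y \<in> set p \<and> edge y \<in> M}"
      "\<forall>u\<in>set (trail_verts r q'). node u \<in> ?N" by blast
  have new: "node (head e) \<notin> ?N" by (rule snoc.hyps(3))
  then have "path B r (q' @ [e])"
    unfolding path_snoc using q' e(3) by auto
  moreover have "node u \<in> insert (Inl r) ((\<lambda>x. node (head x)) ` set (p @ [e])) - {node (head e)}"
    if "u \<in> set (trail_verts r q')" for u
  proof -
    have u: "node u \<in> ?N" using q'(5) that by blast
    then have "node u \<noteq> node (head e)" using new by metis
    then show ?thesis using u by auto
  qed
  ultimately show ?case using q'(4) by (intro exI[of _ "q' @ [e]"]) auto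
qed

text \<open>Undirected edges stay within a node, so the edge by which the path enters
  \<open>X\<close> for the last time is directed. It ends a prefix of the path, so it belongs to
  \<open>D\<close>.\<close>

lemma cut_crossed:
  "path B r p \<Longrightarrow> Inl r \<notin> X \<Longrightarrow> node (endpoint r p) \<in> X \<Longrightarrow>
    \<exists>d\<in>set p \<inter> D. node (tail d) \<notin> X \<and> node (head d) \<in> X"
proof (induction p rule: rev_induct)
  case (snoc x p)
  note x = snoc.prems(1)[unfolded path_snoc]
  show ?case
  proof (cases "node (tail x) \<in> X")
    case True
    then show ?thesis using snoc.IH snoc.prems x by auto
  next
    case False
    moreover have hx: "node (head x) \<in> X" using snoc.prems by simp
    ultimately have "x \<notin> undirected" using undirected_same_node by metis
    moreover have "x \<in> T" using path_T[OF snoc.prems(1)] by simp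
    ultimately have "x \<in> D"
      using snoc.prems(1) unfolding D_def undirected_def by (auto intro!: exI[of _ "p @ [x]"])
    then show ?thesis using False hx by auto
  qed
qed simp

lemma path_conn_le_indeg:
  assumes "X \<in> dg.cuts (node v)"
  shows "path_conn B \<alpha> r v \<le> dg.indeg D X"
proof -
  have "finite (edges B)" using finite by (simp add: finite_graph_def)
  from path_conn_attained[OF this, of r v \<alpha>]
  obtain P where P: "finite P" "\<And>p. p \<in> P \<Longrightarrow> path_to B r v \<alpha> p" "pairwise edge_disjoint P"
    "card P = path_conn B \<alpha> r v" by metis
  have "\<exists>d\<in>set p \<inter> D. node (tail d) \<notin> X \<and> node (head d) \<in> X" if "p \<in> P" for p
    using cut_crossed[of p X] path_to_endpoint[OF P(2)[OF that]] assms unfolding dg.cuts_def by auto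
  then obtain f where f: "\<And>p. p \<in> P \<Longrightarrow> f p \<in> set p \<inter> D \<and> node (tail (f p)) \<notin> X \<and> node (head (f p)) \<in> X"
    by metis
  have "inj_on f P"
  proof (rule inj_onI)
    fix p q assume pq: "p \<in> P" "q \<in> P" "f p = f q"
    then have "edge (f p) \<in> edge ` set p \<inter> edge ` set q" using f[of p] f[of q] by auto
    then show "p = q" using P(3) pq(1,2) unfolding pairwise_def edge_disjoint_def by blast
  qed
  then have "card P \<le> card {e\<in>D. node (tail e) \<notin> X \<and> node (head e) \<in> X}"
    using f finite_D by (intro card_inj_on_le[of f]) auto
  then show ?thesis using P(4) unfolding dg.indeg_def by simp
qed

lemma D_edge_inj:
  assumes "x \<in> T" "flip x \<notin> T" "y \<in> T" "edge x = edge y"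
  shows "x = y"
proof -
  have "x = y \<or> x = flip y"
    using oriented_edges_same_edge assms T_oriented by (metis subsetD)
  then show ?thesis using assms(2,3) by auto
qed

theorem flame_exists:
  "\<exists>F. spanning_subgraph F B \<and> flame F r \<and>
    (\<forall>v\<in>verts B - {r}. \<forall>\<alpha>. path_conn F \<alpha> r v = path_conn B \<alpha> r v)"
proof -
  define S where "S = {(v, \<alpha>). \<exists>p. path_to B r v \<alpha> p}"
  obtain M where M: "finite M" "finite S" "card M \<le> card S"
    "\<And>v \<alpha> p. path_to B r v \<alpha> p \<Longrightarrow> \<exists>q. path_to B r v \<alpha> q \<and> edge ` set q \<subseteq> M"
    by (rule few_edges_reach_all[folded S_def]) (rule that)
  obtain K where K: "K \<subseteq> D" "\<And>v. v \<noteq> Inl r \<Longrightarrow> dg.mincut K v = dg.mincut D v"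
    "\<And>v. v \<noteq> Inl r \<Longrightarrow> card {e\<in>K. node (head e) = v} \<le> dg.mincut K v"
    by (rule dg.cut_flame[OF finite_D]) (rule that)
  have finK: "finite K" using K(1) finite_D by (rule finite_subset)
  define E where "E = edge ` K \<union> (M \<inter> edge ` undirected)"
  define F where "F = B\<lparr>edges := E\<rparr>"
  have E: "E \<subseteq> edges B"
    using K(1) T_oriented oriented_edge_ends by (fastforce simp: E_def D_def undirected_def)
  have fin_edges: "finite (edges B)" "finite (edges F)"
    using finite M(1) finK by (simp_all add: finite_graph_def F_def E_def)
  have to_F: "path_to F r v \<alpha> p \<longleftrightarrow> path_to B r v \<alpha> p \<and> edge ` set p \<subseteq> E" for v \<alpha> p
    unfolding F_def by (rule path_to_restrict[OF E])
  have "\<forall>v \<alpha> p. path_to B r v \<alpha> p \<longrightarrow> (\<exists>q. path_to B r v \<alpha> q \<and> edge ` set q \<subseteq> M)"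
    using M(4) by blast
  note lift = lift_dpath[OF this K(1)]

  have lift_E: "edge ` set q \<subseteq> E" if "set q \<subseteq> set p \<union> {y \<in> undirected. bas y \<in> set p \<and> edge y \<in> M}" "set p \<subseteq> K" for p q
    using that unfolding E_def by auto

  \<comment> \<open>The path \<open>p0\<close> only fixes the sign: all arcs into \<open>v\<close>
    agree with its last edge there, so every lifted path ends with \<alpha>.\<close>
  have conn_Inl: "dg.mincut K (Inl v) \<le> path_conn F \<alpha> r v"
    if v: "node v = Inl v" and p0: "path_to B r v \<alpha> p0" for v \<alpha> p0
  proof -
    note p0' = path_to_endpoint[OF p0]
    have d0: "last p0 \<in> T" "head (last p0) = v"
      using path_T[of p0] p0' endpoint_nonempty[of p0 r] by auto
    then have d0': "flip (last p0) \<notin> T"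
      using node_undirected[of "last p0"] v by (auto simp: undirected_def)
    have "(Inl v :: 'v + ('v, 'e) oedge) \<noteq> Inl r" using p0' by simp
    then obtain P where P: "finite P" "card P = dg.mincut K (Inl v)" "\<And>p. p \<in> P \<Longrightarrow> dg.dpath K p (Inl v)"
      "pairwise (\<lambda>p q. set p \<inter> set q = {}) P"
      by (rule dg.menger[OF finK]) (rule that)
    have P_props: "set p \<subseteq> K" "p \<noteq> []" "head (last p) = v" if "p \<in> P" for p
    proof -
      show "set p \<subseteq> K" using dg.dpath_props[OF P(3)[OF that]] by blast
      show "p \<noteq> []" using P(3)[OF that] p0' by (auto elim: dg.dpath.cases)
      then show "head (last p) = v" using dg.dpath_last[OF P(3)[OF that]] node_Inl by metis
    qed
    have "\<forall>p\<in>P. \<exists>q. path_to F r v \<alpha> q \<and> last q = last p \<and>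
        set q \<subseteq> set p \<union> {y \<in> undirected. bas y \<in> set p}"
    proof
      fix p assume p: "p \<in> P"
      obtain q where q: "path B r q" "q \<noteq> []" "last q = last p"
        "set q \<subseteq> set p \<union> {y \<in> undirected. bas y \<in> set p \<and> edge y \<in> M}"
        using lift[OF P(3)[OF p]] P_props(2)[OF p] by blast
      have "last p \<in> D" using P_props(1,2)[OF p] K(1) last_in_set by blast
      then have "sig B (edge (last p)) v = sig B (edge (last p0)) v"
        using directed_sign[of "last p" "last p0"] d0 d0' P_props(3)[OF p] by (simp add: D_def)
      then have "path_to B r v \<alpha> q"
        using q(1-3) P_props(3)[OF p] p0' by (simp add: path_to_def)
      moreover have "edge ` set q \<subseteq> E" by (rule lift_E[OF q(4) P_props(1)[OF p]])
      ultimately have "path_to F r v \<alpha> q" using to_F by blast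
      then show "\<exists>q. path_to F r v \<alpha> q \<and> last q = last p \<and>
          set q \<subseteq> set p \<union> {y \<in> undirected. bas y \<in> set p}" using q(3,4) by blast
    qed
    from bchoice[OF this] obtain g where "\<forall>p\<in>P. path_to F r v \<alpha> (g p) \<and> last (g p) = last p \<and>
        set (g p) \<subseteq> set p \<union> {y \<in> undirected. bas y \<in> set p}" ..
    then have g: "\<And>p. p \<in> P \<Longrightarrow> path_to F r v \<alpha> (g p)" "\<And>p. p \<in> P \<Longrightarrow> last (g p) = last p"
      "\<And>p. p \<in> P \<Longrightarrow> set (g p) \<subseteq> set p \<union> {y \<in> undirected. bas y \<in> set p}"
      by simp_all
    \<comment> \<open>A common undirected edge has its base on both digraph paths, and a common
      directed edge lies on both itself.\<close>
    have disjoint: "p = q" if pq: "p \<in> P" "q \<in> P" "x \<in> set (g p)" "y \<in> set (g q)" "edge x = edge y" for p q x y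
    proof -
      have common: "p = q" if "z \<in> set p" "z \<in> set q" for z
        using P(4) pq(1,2) that unfolding pairwise_def by blast
      have x: "x \<in> set p \<or> x \<in> undirected \<and> bas x \<in> set p" and y: "y \<in> set q \<or> y \<in> undirected \<and> bas y \<in> set q"
        using g(3) pq by blast+
      have dir: "z \<in> T \<and> flip z \<notin> T" if "z \<in> set p \<or> z \<in> set q" for z
        using P_props(1) pq(1,2) K(1) that unfolding D_def by blast
      have xy: "x = y \<or> x = flip y"
      proof -
        have "x \<in> T" "y \<in> T" using x y dir unfolding undirected_def by blast+
        then show ?thesis using oriented_edges_same_edge[OF _ _ pq(5)] T_oriented by blast
      qed
      show ?thesis
      proof (cases "x \<in> undirected")
        case True
        then have u: "y \<in> undirected" "bas x = bas y"
          using xy bas_flip[of y] by (auto simp: undirected_def)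
        have "x \<notin> set p" "y \<notin> set q" using True u(1) dir unfolding undirected_def by blast+
        then have "bas x \<in> set p" "bas x \<in> set q" using x y u(2) by simp_all
        then show ?thesis by (rule common)
      next
        case False
        then have "y \<notin> undirected" using xy by (auto simp: undirected_def)
        then have "x \<in> set p" "y \<in> set q" using False x y by auto
        moreover from this have "x = y" using D_edge_inj[of x y] dir pq(5) by blast
        ultimately show ?thesis using common by blast
      qed
    qed
    have inj: "inj_on g P"
    proof (rule inj_onI)
      fix p q assume pq: "p \<in> P" "q \<in> P" "g p = g q"
      have "last (g p) \<in> set (g p)" using path_to_endpoint[OF g(1)[OF pq(1)]] by simp
      then show "p = q" using disjoint[OF pq(1,2)] pq(3) by metis
    qed
    have "pairwise edge_disjoint (g ` P)"
      unfolding pairwise_def edge_disjoint_def using disjoint by blast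
    then have "card (g ` P) \<le> path_conn F \<alpha> r v"
      using P(1) g(1) by (intro path_conn_ge[OF fin_edges(2)]) auto
    then show ?thesis using P(2) card_image[OF inj] by simp
  qed

  \<comment> \<open>A single path is enough, since \<open>b\<close> is the only arc that can enter
    this node and caps the connectivity in \<open>B\<close> at one.\<close>
  have conn_Inr: "1 \<le> path_conn F \<alpha> r v"
    if v: "node v = Inr b" and p0: "path_to B r v \<alpha> p0" for v b \<alpha> p0
  proof -
    note p0' = path_to_endpoint[OF p0]
    have "1 \<le> dg.indeg D X" if X: "X \<in> dg.cuts (Inr b)" for X
    proof -
      have "\<exists>d\<in>set p0 \<inter> D. node (tail d) \<notin> X \<and> node (head d) \<in> X"
        using X p0' v by (intro cut_crossed) (simp_all add: dg.cuts_def)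
      then have "{e\<in>D. node (tail e) \<notin> X \<and> node (head e) \<in> X} \<noteq> {}" by blast
      then show ?thesis using finite_D by (simp add: dg.indeg_def Suc_le_eq card_gt_0_iff)
    qed
    then have "1 \<le> dg.mincut D (Inr b)" using dg.mincut_attained[of "Inr b" D] by (metis Inl_Inr_False)
    then have "1 \<le> dg.mincut K (Inr b)" using K(2) by simp
    moreover obtain P where P: "card P = dg.mincut K (Inr b)" "\<And>p. p \<in> P \<Longrightarrow> dg.dpath K p (Inr b)"
      using dg.menger[OF finK, of "Inr b"] by (metis Inl_Inr_False)
    ultimately obtain p where p: "dg.dpath K p (Inr b)" by fastforce
    then have "p \<noteq> []" by (auto elim: dg.dpath.cases)
    then obtain q where q: "path B r q" "q \<noteq> []" "last q = last p"
      "set q \<subseteq> set p \<union> {y \<in> undirected. bas y \<in> set p \<and> edge y \<in> M}"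
      "\<forall>u\<in>set (butlast (trail_verts r q)). node u \<noteq> Inr b"
      using lift[OF p] by blast
    have pK: "set p \<subseteq> K" using dg.dpath_props[OF p] by blast
    then have "last p \<in> D" using \<open>p \<noteq> []\<close> K(1) last_in_set by blast
    then have b: "last p = b" using D_node_Inr dg.dpath_last[OF p \<open>p \<noteq> []\<close>] by blast
    obtain p1 where p1: "path_to B r v \<alpha> p1" "edge ` set p1 \<subseteq> M" using M(4)[OF p0] by blast
    obtain c where c: "path_to B r v \<alpha> (q @ c)" "set c \<subseteq> {y \<in> undirected. bas y = b} \<inter> set p1"
      using enter_blossom[OF q(1,2) _ q(5) p1(1) v] q(3) b by blast
    have "edge ` set c \<subseteq> E" using c(2) p1(2) unfolding E_def by blast
    then have "path_to F r v \<alpha> (q @ c)"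
      using to_F c(1) lift_E[OF q(4) pK] by (simp add: image_Un)
    then have "card {q @ c} \<le> path_conn F \<alpha> r v"
      by (intro path_conn_ge[OF fin_edges(2)]) simp_all
    then show ?thesis by simp
  qed

  have conn_eq: "path_conn F \<alpha> r v = path_conn B \<alpha> r v" if vr: "v \<noteq> r" for v \<alpha>
  proof (rule antisym)
    obtain P where P: "finite P" "\<And>p. p \<in> P \<Longrightarrow> path_to F r v \<alpha> p" "pairwise edge_disjoint P"
      "card P = path_conn F \<alpha> r v" by (rule path_conn_attained[OF fin_edges(2)]) (rule that)
    then show "path_conn F \<alpha> r v \<le> path_conn B \<alpha> r v"
      using path_conn_ge[OF fin_edges(1) P(1) _ P(3)] to_F by metis
    obtain Q where Q: "\<And>p. p \<in> Q \<Longrightarrow> path_to B r v \<alpha> p"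
      "card Q = path_conn B \<alpha> r v" by (rule path_conn_attained[OF fin_edges(1)]) (rule that)
    show "path_conn B \<alpha> r v \<le> path_conn F \<alpha> r v"
    proof (cases "Q = {}")
      case True
      then show ?thesis using Q(2) by simp
    next
      case False
      then obtain p0 where p0: "path_to B r v \<alpha> p0" using Q(1) by blast
      show ?thesis
      proof (cases "node v")
        case (Inl w)
        then have v: "node v = Inl v" using node_Inl by blast
        have ne: "(Inl v :: 'v + ('v, 'e) oedge) \<noteq> Inl r" using vr by simp
        obtain X where X: "X \<in> dg.cuts (Inl v)" "dg.indeg D X = dg.mincut D (Inl v)"
          by (rule dg.mincut_attained[OF ne])
        have "path_conn B \<alpha> r v \<le> dg.mincut D (Inl v)"
          using path_conn_le_indeg[of X v \<alpha>] X v by simp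
        also have "\<dots> = dg.mincut K (Inl v)" using K(2)[OF ne] by simp
        also have "\<dots> \<le> path_conn F \<alpha> r v" by (rule conn_Inl[OF v p0])
        finally show ?thesis .
      next
        case (Inr b)
        have "path_conn B \<alpha> r v \<le> dg.indeg D {Inr b}"
          by (rule path_conn_le_indeg) (simp add: dg.cuts_def Inr)
        also have "\<dots> \<le> card {b}"
          unfolding dg.indeg_def using D_node_Inr by (intro card_mono) blast+
        also have "\<dots> \<le> path_conn F \<alpha> r v" using conn_Inr[OF Inr p0] by simp
        finally show ?thesis .
      qed
    qed
  qed

  \<comment> \<open>Counting the edges of \<open>F\<close>\<close>
  define U where "U = {v \<in> verts B - {r}. \<exists>w. node v = Inl w}"
  define W where "W = {v \<in> verts B - {r}. \<exists>b. node v = Inr b}"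
  define c where "c v = (\<Sum>\<alpha>\<in>{Plus, Minus}. path_conn F \<alpha> r v)" for v
  have "(\<exists>w. node v = Inl w) \<or> (\<exists>b. node v = Inr b)" for v by (cases "node v") blast+
  then have UW: "U \<union> W = verts B - {r}" unfolding U_def W_def by blast
  have disjoint: "U \<inter> W = {}" unfolding U_def W_def by force
  have finUW: "finite U" "finite W" using finite by (auto simp: U_def W_def finite_graph_def)
  have single: "path_conn F \<alpha> r v \<le> c v" for \<alpha> v by (cases \<alpha>) (simp_all add: c_def)
  have in_S: "v \<in> verts B \<and> v \<noteq> r" if "path_to B r v \<alpha> p" for v \<alpha> p
  proof -
    note p = path_to_endpoint[OF that]
    then have "last p \<in> oriented_edges B" using path_edges[of B r p] by auto
    then show ?thesis using p oriented_edges_verts endpoint_nonempty[of p r] by auto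
  qed
  have D_path: "\<exists>p. path_to B r (head d) (sig B (edge d) (head d)) p" if "d \<in> D" for d
    using that unfolding D_def path_to_def by auto

  define K1 where "K1 = {d\<in>K. head d \<in> U}"
  define K2 where "K2 = {d\<in>K. head d \<in> W}"
  have "head d \<in> U \<union> W" if "d \<in> K" for d
    using that D_path[of d] in_S K(1) unfolding UW by blast
  then have K_eq: "K = K1 \<union> K2" unfolding K1_def K2_def by blast
  moreover have "K1 \<inter> K2 = {}" using disjoint unfolding K1_def K2_def by blast
  moreover have "finite K1" "finite K2" using finK unfolding K_eq by simp_all
  ultimately have cardK: "card K = card K1 + card K2" by (simp add: card_Un_disjoint)

  have K1_le: "card K1 \<le> (\<Sum>v\<in>U. c v)"
  proof -
    have K1_eq: "K1 = (\<Union>v\<in>U. {d\<in>K. head d = v})" unfolding K1_def by blast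
    have "card K1 \<le> (\<Sum>v\<in>U. card {d\<in>K. head d = v})"
      unfolding K1_eq by (rule card_UN_le[OF finUW(1)])
    also have "\<dots> \<le> (\<Sum>v\<in>U. c v)"
    proof (rule sum_mono)
      fix v assume "v \<in> U"
      then obtain w where "node v = Inl w" "v \<noteq> r" unfolding U_def by blast
      then have v: "node v = Inl v" "v \<noteq> r" using node_Inl[of v w] by simp_all
      show "card {d\<in>K. head d = v} \<le> c v"
      proof (cases "{d\<in>K. head d = v} = {}")
        case True
        show ?thesis unfolding True by simp
      next
        case False
        then obtain d where d: "d \<in> K" "head d = v" by blast
        \<comment> \<open>An arc of \<open>D\<close> ends some path, whose sign at \<open>v\<close>
          is the one to which all arcs into \<open>v\<close> are charged.\<close>
        then obtain \<alpha> p where p: "path_to B r v \<alpha> p" using D_path[of d] K(1) by blast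
        have "card {d\<in>K. head d = v} \<le> card {d\<in>K. node (head d) = Inl v}"
          using finK v(1) by (intro card_mono) auto
        also have "\<dots> \<le> dg.mincut K (Inl v)" using K(3) v(2) by simp
        also have "\<dots> \<le> path_conn F \<alpha> r v" by (rule conn_Inl[OF v(1) p])
        also have "\<dots> \<le> c v" by (rule single)
        finally show ?thesis .
      qed
    qed
    finally show ?thesis .
  qed

  define S1 where "S1 = {(v, \<alpha>) \<in> S. v \<in> U}"
  define S2 where "S2 = {(v, \<alpha>) \<in> S. v \<in> W}"
  have "v \<in> U \<union> W" if "(v, \<alpha>) \<in> S" for v \<alpha>
    using that in_S unfolding UW S_def by blast
  then have S_eq: "S = S1 \<union> S2" unfolding S1_def S2_def by blast
  moreover have "S1 \<inter> S2 = {}" using disjoint unfolding S1_def S2_def by blast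
  moreover have "finite S1" "finite S2" using M(2) unfolding S_eq by simp_all
  ultimately have cardS: "card S = card S1 + card S2" by (simp add: card_Un_disjoint)
  have S2_le: "card S2 \<le> (\<Sum>v\<in>W. c v)"
  proof -
    have "\<alpha> \<in> {Plus, Minus}" for \<alpha> by (cases \<alpha>) simp_all
    then have sub: "S2 \<subseteq> W \<times> {Plus, Minus}" unfolding S2_def by blast
    have "card S2 = (\<Sum>x\<in>S2. 1)" by simp
    also have "\<dots> \<le> (\<Sum>x\<in>S2. path_conn F (snd x) r (fst x))"
    proof (rule sum_mono)
      fix x assume "x \<in> S2"
      then obtain b p where "node (fst x) = Inr b" "path_to B r (fst x) (snd x) p"
        unfolding S2_def S_def W_def by auto
      then show "1 \<le> path_conn F (snd x) r (fst x)" by (rule conn_Inr)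
    qed
    also have "\<dots> \<le> (\<Sum>x\<in>W \<times> {Plus, Minus}. path_conn F (snd x) r (fst x))"
      by (rule sum_mono2[OF _ sub]) (simp_all add: finUW(2))
    also have "\<dots> = (\<Sum>v\<in>W. c v)"
      unfolding c_def sum.cartesian_product by (simp add: case_prod_beta)
    finally show ?thesis .
  qed

  text \<open>Every reached blossom and every reached sign at a vertex outside the blossoms
    accounts for its own directed edge in \<open>M\<close>; only the rest of \<open>M\<close> can be undirected.\<close>
  define H where "H = {d\<in>T. flip d \<notin> T \<and> edge d \<in> M}"
  have inj_H: "inj_on edge H"
  proof (rule inj_onI)
    fix x y assume "x \<in> H" "y \<in> H" "edge x = edge y"
    then show "x = y" by (intro D_edge_inj) (simp_all add: H_def)
  qed
  have "edge d \<notin> edge ` undirected" if "d \<in> H" for d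
  proof
    assume "edge d \<in> edge ` undirected"
    then obtain y where y: "y \<in> undirected" "edge d = edge y" by (elim imageE)
    have "d = y" by (rule D_edge_inj) (use y that in \<open>simp_all add: H_def undirected_def\<close>)
    then show False using y(1) that by (simp add: H_def undirected_def)
  qed
  moreover have "edge d \<in> M" if "d \<in> H" for d using that by (simp add: H_def)
  ultimately have "edge ` H \<subseteq> M - edge ` undirected" by (intro image_subsetI DiffI)
  then have H_le: "card H \<le> card (M - edge ` undirected)"
    by (rule card_inj_on_le[OF inj_H]) (simp add: M(1))
  have "H \<subseteq> oriented_edges B" using T_oriented unfolding H_def by blast
  then have finH: "finite H" using finite_oriented_edges by (rule finite_subset)
  have last_H: "last q \<in> T" "edge (last q) \<in> M" "head (last q) = v" "sig B (edge (last q)) v = \<alpha>"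
    if "path_to B r v \<alpha> q" "edge ` set q \<subseteq> M" for v \<alpha> q
  proof -
    note q = path_to_endpoint[OF that(1)]
    then have l: "last q \<in> set q" by simp
    then show "last q \<in> T" using path_T[of q] q by blast
    show "edge (last q) \<in> M" using l that(2) by blast
    show "head (last q) = v" "sig B (edge (last q)) v = \<alpha>"
      using q endpoint_nonempty[of q r] by simp_all
  qed
  let ?H1 = "{d\<in>H. head d \<in> U}"
  have "S1 \<subseteq> (\<lambda>d. (head d, sig B (edge d) (head d))) ` ?H1"
  proof
    fix x assume "x \<in> S1"
    then obtain v \<alpha> p where x: "x = (v, \<alpha>)" "path_to B r v \<alpha> p" "v \<in> U"
      unfolding S1_def S_def by auto
    obtain q where "path_to B r v \<alpha> q" "edge ` set q \<subseteq> M" using M(4)[OF x(2)] by blast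
    note q = last_H[OF this]
    obtain w where "node v = Inl w" using x(3) unfolding U_def by blast
    then have "flip (last q) \<notin> T"
      using node_undirected[of "last q"] q by (auto simp: undirected_def)
    then show "x \<in> (\<lambda>d. (head d, sig B (edge d) (head d))) ` ?H1"
      using q x by (intro image_eqI[of _ _ "last q"]) (simp_all add: H_def)
  qed
  then have S1_le:
    "card S1 \<le> card ?H1"
    using finH by (intro surj_card_le) auto
  \<comment> \<open>The base of a blossom lies on every path to a vertex in it, in particular on one
    within \<open>M\<close>. So \<open>M\<close> contains every arc of \<open>K\<close> that enters
    a blossom.\<close>
  have "K2 \<subseteq> H - ?H1"
  proof
    fix d assume d: "d \<in> K2"
    then obtain b where b: "node (head d) = Inr b" "d \<in> D" using K(1) unfolding K2_def W_def by blast
    then have db: "d = b" by (intro D_node_Inr) simp_all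
    obtain q where q: "path_to B r (head d) (sig B (edge d) (head d)) q" "edge ` set q \<subseteq> M"
      using D_path[OF b(2)] M(4)[of "head d" "sig B (edge d) (head d)"] by blast
    note l = last_H[OF q]
    have "bas (last q) = b" using node_Inr[of "last q" b] l b(1) by simp
    moreover have "last q \<in> set q" "path B r q" using path_to_endpoint[OF q(1)] by simp_all
    ultimately have "d \<in> set q" using path_bas[of q] db by blast
    then have "edge d \<in> M" using q(2) by blast
    then have "d \<in> H" using b(2) unfolding H_def D_def by simp
    moreover have "head d \<notin> U" using d disjoint unfolding K2_def by blast
    ultimately show "d \<in> H - ?H1" by simp
  qed
  then have "card K2 \<le> card (H - ?H1)" using finH by (intro card_mono) auto
  also have "\<dots> = card H - card ?H1" using finH by (intro card_Diff_subset) auto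
  finally have "card K2 + card S1 \<le> card H"
    using S1_le card_mono[OF finH, of ?H1] by auto
  then have "card K2 + card S1 + card (M \<inter> edge ` undirected) \<le> card M"
    using H_le M(1) card_Diff_subset_Int[of M "edge ` undirected"] card_mono[OF M(1), of "M \<inter> edge ` undirected"]
    by auto
  \<comment> \<open>\<open>S1\<close> cancels from \<open>card M \<le> card S1 + card S2\<close>,
    leaving only pairs inside the blossoms to pay for \<open>K2\<close> and the undirected
    edges.\<close>
  then have rest: "card K2 + card (M \<inter> edge ` undirected) \<le> card S2"
    using M(3) cardS by linarith

  have "card E \<le> card (edge ` K) + card (M \<inter> edge ` undirected)"
    unfolding E_def by (rule card_Un_le)
  also have "card (edge ` K) \<le> card K" using finK by (rule card_image_le)
  finally have "card E \<le> (\<Sum>v\<in>U. c v) + (\<Sum>v\<in>W. c v)"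
    using cardK K1_le rest S2_le by linarith
  also have "\<dots> = (\<Sum>v\<in>verts B - {r}. c v)"
    using sum.union_disjoint[OF finUW disjoint, of c] UW by simp
  finally have "flame F r" unfolding flame_def c_def by (simp add: F_def)
  moreover have "spanning_subgraph F B"
    using E bidirected
    unfolding spanning_subgraph_def subgraph_def bidirected_graph_def F_def by auto
  ultimately show ?thesis using conn_eq by (intro exI[of _ F]) blast
qed

end

theorem theorem5p2:
  fixes B :: "('v, 'e) bidir_graph" and r :: 'v
  assumes "bidirected_graph B" and "finite_graph B" and "r \<in> verts B" and "edge_clean B r"
  shows "\<exists>F :: ('v, 'e) bidir_graph. spanning_subgraph F B \<and> flame F r \<and>
    (\<forall>v\<in>verts B - {r}. \<forall>\<alpha>. path_conn F \<alpha> r v = path_conn B \<alpha> r v)"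
proof -
  interpret finite_rooted B r using assms(1-3) by unfold_locales
  obtain T bas where T: "T \<subseteq> oriented_edges B"
    "\<And>p. path B r p \<Longrightarrow> set p \<subseteq> T \<and> bas ` set p \<subseteq> set p"
    "\<And>x. x \<in> T \<Longrightarrow> bas x \<in> T" "\<And>x. x \<in> T \<Longrightarrow> flip (bas x) \<notin> T"
    "\<And>x. x \<in> T \<Longrightarrow> flip x \<notin> T \<Longrightarrow> bas x = x"
    "\<And>x. x \<in> T \<Longrightarrow> flip x \<in> T \<Longrightarrow> bas (flip x) = bas x"
    "\<And>x. x \<in> T \<Longrightarrow> head x \<noteq> r"
    "\<And>x. x \<in> T \<Longrightarrow> tail x \<noteq> r \<Longrightarrow> \<exists>z\<in>T. follows B z x \<and> bas z \<noteq> x"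
    "\<And>x y. x \<in> T \<Longrightarrow> y \<in> T \<Longrightarrow> follows B x (flip y) \<Longrightarrow> bas x = bas y"
    by (rule trail_blossoms[OF assms(4)]) (rule that)
  interpret trail_structure B r T bas
    by unfold_locales (use T in simp_all)
  show ?thesis by (rule flame_exists)
qed

end
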